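(* Let $k\ge1$ and $n-(2k+1)\ge4$, and let $\mu_3$ be the $n$-dimensional Leibniz algebra over $\mathbb{C}$ with basis $\{e_1,\dots,e_{n-2k},f_1,\dots,f_{2k}\}$ and products $$[e_1,e_1]=e_3,\quad [e_i,e_1]=e_{i+1}\ (2\le i\le n-2k-1),\quad [e_1,f_j]=f_{k+j},\quad [e_2,f_j]=f_{k+j}\ (1\le j\le k),$$ other products zero. Let $R$ be a solvable Leibniz algebra over $\mathbb{C}$ of dimension $n+1$ with nilradical $\mu_3$ and let $x$ span a complement of $\mu_3$ in $R$. Let $\mathcal{F}=\operatorname{span}\{f_1,\dots,f_k\}$ and let $\varepsilon(\mathcal{R}_x|_{\mathcal{F}}):\mathcal{F}\to\mathcal{F}$ be the composition of $\mathcal{R}_x|_{\mathcal{F}}$ with the projection onto $\mathcal{F}$ along the span of the remaining basis vectors of $\mu_3$. Assume that there is a basis of $\mathcal{F}$ in which $\varepsilon(\mathcal{R}_x|_{\mathcal{F}})$ is a single Jordan block $J_\lambda$ with $\lambda\neq0$. Then $R$ admits a basis $\{e_1,\dots,e_{n-2k},f_1,\dots,f_{2k},x\}$ in which the multiplication table is $$\begin{array}{ll} [e_i,e_1]=e_{i+1},&2\le i\le n-2k-1,\\ {}[e_2,f_i]=f_{k+i},&1\le i\le k,\\ {}[e_1,x]=a_1e_1+a_{n-2k}e_{n-2k}+b_1f_1+b_2f_{k+1},&\\ {}[e_2,x]=(a_1+a_2)e_2+\sum_{i=4}^{n-2k-1}a_ie_i+\beta e_{n-2k},&\\ {}[e_3,x]=(2a_1+a_2)e_3+\sum_{i=5}^{n-2k}a_{i-1}e_i+b_1f_{k+1},&\\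 {}[e_i,x]=((i-1)a_1+a_2)e_i+\sum_{j=i+2}^{n-2k}a_{j-i+2}e_j,&4\le i\le n-2k,\\ {}[f_i,x]=-[x,f_i]=f_i+f_{i+1},&1\le i\le k-1,\\ {}[f_k,x]=-[x,f_k]=f_k,&\\ {}[f_{k+i},x]=(a_1+a_2+1)f_{k+i}+f_{k+i+1},&1\le i\le k-1,\\ {}[f_{2k},x]=(a_1+a_2+1)f_{2k},&\\ {}[x,e_1]=-a_1e_1-b_1f_1+\sum_{i=1}^{k}\theta_{n-k+i}f_{k+i},&\\ {}[x,e_2]=\gamma e_{n-2k},&\\ {}[x,x]=\delta_1e_{n-2k-1}+\delta_2e_{n-2k}+\delta_3f_{k+1},& \end{array}$$ all products of basis elements not listed being zero, for some complex parameters $a_i$ ($1\le i\le n-2k$, $i\ne3$), $b_1,b_2,\beta,\gamma,\delta_1,\delta_2,\delta_3$, $\theta_{n-k+j}$ ($1\le j\le k$) satisfying $$(a_1+a_2)\gamma=0,\quad (n-2k-2)a_1\gamma=0,\quad \delta_1=-a_1a_{n-2k},\quad a_1b_2=(-1)^{k-1}(a_2+1)^k\theta_n,$$ $$\theta_{n-i}=(-1)^i(a_2+1)^i\theta_n\quad(0\le i\le k-1).$$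
   Context: All algebras are finite-dimensional over $\mathbb{C}$. A (right) Leibniz algebra is a vector space $L$ with a bilinear bracket satisfying $[x,[y,z]]=[[x,y],z]-[[x,z],y]$ for all $x,y,z\in L$. $L$ is solvable if its derived series $L^{[1]}=L$, $L^{[j+1]}=[L^{[j]},L^{[j]}]$ reaches $0$, nilpotent if its lower central series $L^1=L$, $L^{j+1}=[L^j,L]$ reaches $0$. The nilradical is the maximal nilpotent ideal. $\mathcal{R}_x$ denotes right multiplication, $\mathcal{R}_x(y)=[y,x]$; it maps the nilradical to itself. Empty sums are $0$, and powers with exponent $0$ equal $1$. *)

theory Defs
  imports "Jordan_Normal_Form.Jordan_Normal_Form"
begin

text \<open>
  An algebra is carried by a whole type \<open>'a\<close>, with scalar multiplication \<open>scale\<close> over the complex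
  numbers. Finite-dimensionality is not part of the locale; it is imposed where \<open>dim UNIV\<close> is
  required to be a positive number, since \<open>dim\<close> is 0 on spaces without a finite basis.
\<close>

locale leibniz_algebra = vector_space scale
  for scale :: "complex \<Rightarrow> 'a::ab_group_add \<Rightarrow> 'a" (infixr "*s" 75) +
  fixes br :: "'a \<Rightarrow> 'a \<Rightarrow> 'a"
  assumes linear_br_left: "Vector_Spaces.linear scale scale (\<lambda>y. br y x)"
    and linear_br_right: "Vector_Spaces.linear scale scale (\<lambda>y. br x y)"
    and right_leibniz: "br x (br y z) = br (br x y) z - br (br x z) y"
begin

definition bracket_space :: "'a set \<Rightarrow> 'a set \<Rightarrow> 'a set" where
  "bracket_space U V = span {br u v | u v. u \<in> U \<and> v \<in> V}"

text \<open>Both series are indexed from 0 here, so that \<open>derived_series j\<close> is $L^{[j+1]}$ and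
  \<open>lower_central_series I j\<close> is $I^{j+1}$, for the subalgebra \<open>I\<close> regarded as an algebra itself.\<close>

primrec derived_series :: "nat \<Rightarrow> 'a set" where
  "derived_series 0 = UNIV"
| "derived_series (Suc j) = bracket_space (derived_series j) (derived_series j)"

definition solvable :: bool where
  "solvable \<longleftrightarrow> (\<exists>j. derived_series j = {0})"

primrec lower_central_series :: "'a set \<Rightarrow> nat \<Rightarrow> 'a set" where
  "lower_central_series I 0 = I"
| "lower_central_series I (Suc j) = bracket_space (lower_central_series I j) I"

definition nilpotent :: "'a set \<Rightarrow> bool" where
  "nilpotent I \<longleftrightarrow> (\<exists>j. lower_central_series I j = {0})"

definition two_sided_ideal :: "'a set \<Rightarrow> bool" where
  "two_sided_ideal I \<longleftrightarrow> subspace I \<and> (\<forall>a\<in>I. \<forall>b. br a b \<in> I \<and> br b a \<in> I)"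

text \<open>In finite dimension the maximal nilpotent ideal is unique.\<close>

definition is_nilradical :: "'a set \<Rightarrow> bool" where
  "is_nilradical N \<longleftrightarrow> two_sided_ideal N \<and> nilpotent N \<and>
     (\<forall>I. two_sided_ideal I \<and> nilpotent I \<and> N \<subseteq> I \<longrightarrow> I = N)"

definition complementary :: "'a set \<Rightarrow> 'a set \<Rightarrow> bool" where
  "complementary U V \<longleftrightarrow> U \<inter> V = {0} \<and> {u + v | u v. u \<in> U \<and> v \<in> V} = UNIV"

definition ordered_basis :: "'a set \<Rightarrow> 'a list \<Rightarrow> bool" where
  "ordered_basis V bs \<longleftrightarrow> distinct bs \<and> independent (set bs) \<and> span (set bs) = V"

text \<open>The \<open>j\<close>-th column holds the coordinates of the image of the \<open>j\<close>-th basis vector.\<close>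

definition matrix_of :: "('a \<Rightarrow> 'a) \<Rightarrow> 'a list \<Rightarrow> complex mat" where
  "matrix_of T bs = mat (length bs) (length bs)
     (\<lambda>(i, j). representation (set bs) (T (bs ! j)) (bs ! i))"

text \<open>For linearly independent \<open>A \<union> B\<close> with \<open>A\<close>, \<open>B\<close> disjoint, this is the projection of the span
  of \<open>A \<union> B\<close> onto the span of \<open>A\<close> along the span of \<open>B\<close>.\<close>

definition projection_along :: "'a set \<Rightarrow> 'a set \<Rightarrow> 'a \<Rightarrow> 'a" where
  "projection_along A B v = (\<Sum>a\<in>A. representation (A \<union> B) v a *s a)"

definition right_mult :: "'a \<Rightarrow> 'a \<Rightarrow> 'a" where
  "right_mult x y = br y x"

text \<open>The subspace \<open>N\<close> is a copy of the algebra $\mu_3$, with standard basis \<open>e 1, \<dots>, e (n - 2 * k)\<close>,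
  \<open>f 1, \<dots>, f (2 * k)\<close>; values of \<open>e\<close> and \<open>f\<close> outside these index ranges are irrelevant.\<close>

definition is_mu3 :: "nat \<Rightarrow> nat \<Rightarrow> 'a set \<Rightarrow> (nat \<Rightarrow> 'a) \<Rightarrow> (nat \<Rightarrow> 'a) \<Rightarrow> bool" where
  "is_mu3 n k N e f \<longleftrightarrow>
     ordered_basis N (map e [1..<n - 2 * k + 1] @ map f [1..<2 * k + 1]) \<and>
     (\<forall>i\<in>{1..n - 2 * k}. \<forall>j\<in>{1..n - 2 * k}. br (e i) (e j) =
        (if i = 1 \<and> j = 1 then e 3
         else if 2 \<le> i \<and> i \<le> n - 2 * k - 1 \<and> j = 1 then e (i + 1)
         else 0)) \<and>
     (\<forall>i\<in>{1..n - 2 * k}. \<forall>j\<in>{1..2 * k}. br (e i) (f j) =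
        (if (i = 1 \<or> i = 2) \<and> j \<le> k then f (k + j) else 0)) \<and>
     (\<forall>i\<in>{1..2 * k}. \<forall>j\<in>{1..n - 2 * k}. br (f i) (e j) = 0) \<and>
     (\<forall>i\<in>{1..2 * k}. \<forall>j\<in>{1..2 * k}. br (f i) (f j) = 0)"

text \<open>The operator $\varepsilon(\mathcal{R}_x|_{\mathcal{F}})$ on the span of \<open>f 1, \<dots>, f k\<close>.\<close>

definition eps_right_mult ::
    "nat \<Rightarrow> nat \<Rightarrow> (nat \<Rightarrow> 'a) \<Rightarrow> (nat \<Rightarrow> 'a) \<Rightarrow> 'a \<Rightarrow> 'a \<Rightarrow> 'a" where
  "eps_right_mult n k e f x v =
     projection_along (f ` {1..k}) (e ` {1..n - 2 * k} \<union> f ` {k + 1..2 * k}) (right_mult x v)"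

text \<open>Whether the ones are placed above or below the diagonal is immaterial for the existence of
  such a basis, as reversing the basis exchanges the two.\<close>

definition single_jordan_block :: "'a set \<Rightarrow> ('a \<Rightarrow> 'a) \<Rightarrow> nat \<Rightarrow> complex \<Rightarrow> bool" where
  "single_jordan_block V T k c \<longleftrightarrow>
     (\<exists>gs. ordered_basis V gs \<and> matrix_of T gs = jordan_block k c)"

end

end

theory Submission
  imports Defs
begin

text \<open>Put \<open>m = n - 2 * k\<close>, so \<open>m \<ge> 5\<close>. Replacing \<open>e 1\<close> by \<open>e 1 - e 2\<close> kills the square of \<open>e 1\<close> and its
products with all \<open>f j\<close>; the ideal is then described by \<open>[e i, e 1] = e (i + 1)\<close> for \<open>i \<ge> 2\<close> and
\<open>[e 2, f j] = f (k + j)\<close>. Dividing \<open>x\<close> by \<open>\<lambda>\<close> and rescaling a Jordan basis of \<open>f 1, \<dots>, f k\<close> turns the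
Jordan block into the one with eigenvalue 1 (\<open>frame_of_mu3\<close>).

Right multiplication by \<open>x\<close> is a derivation, so it is determined on the ideal by its values on \<open>e 1\<close>,
\<open>e 2\<close>, \<open>f 1, \<dots>, f k\<close>, and applying it to the zero products of these generators removes most of
their coordinates (\<open>right_e1\<close>, \<open>right_e2\<close>, \<open>right_f\<close>). Left multiplication by \<open>x\<close> is controlled by the
fact that all elements \<open>[y, z] + [z, y]\<close> and \<open>[y, y]\<close> are annihilated by every left multiplication:
it is minus right multiplication up to elements \<open>e i\<close> with \<open>i \<ge> 2\<close> and \<open>f (k + j)\<close>, and it kills the
\<open>e i\<close> with \<open>i \<ge> 3\<close> and the \<open>f (k + j)\<close>.

The rest is a sequence of basis changes. The order matters. First \<open>x\<close> is changed by elements of the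
span of the \<open>e i\<close> to remove the coordinates at \<open>e i\<close> with \<open>i \<ge> 2\<close> from \<open>[x, e 1]\<close> and the \<open>e 3\<close>-coordinate from
\<open>[e 2, x]\<close>. Then, the Jordan block being invertible, the \<open>f j\<close> are changed by central elements of
the ideal so that \<open>[x, f j]\<close> is exactly minus the Jordan block (\<open>normal_frame_exists\<close>). At this
point the Leibniz identity alone makes \<open>[f j, x]\<close> exact as well (\<open>right_f_exact\<close>) and yields all
relations between the parameters (\<open>normal_relations\<close>, \<open>normal_left_e2\<close>). Finally, \<open>e 1\<close>, \<open>e 2\<close>,
\<open>e 3\<close> and \<open>x\<close> are changed by combinations of the \<open>f j\<close>. This changes the \<open>f\<close>-coordinates of
\<open>[e 1, x]\<close> and \<open>[x, x]\<close> by elements of the image of a translate \<open>J + c\<close> of a single Jordan block, whose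
cokernel is spanned by the class of the first basis vector (\<open>jordan_cokernel\<close>); hence only
multiples of \<open>f 1\<close> and \<open>f (k + 1)\<close> survive, whatever the value of \<open>c\<close>. The coordinates of \<open>[e 2, x]\<close>
at the \<open>f (k + j)\<close> are moved by \<open>J\<close> itself, which is invertible, and disappear altogether.\<close>

section \<open>Bilinearity and linear combinations\<close>

context leibniz_algebra
begin

lemma br_add_left: "br (a + b) y = br a y + br b y"
  and br_scale_left: "br (c *s a) y = c *s br a y"
  and br_sum_left: "br (sum g A) y = (\<Sum>i\<in>A. br (g i) y)"
  and br_zero_left: "br 0 y = 0"
  and br_minus_left: "br (- a) y = - br a y"
  and br_diff_left: "br (a - b) y = br a y - br b y"
proof -
  interpret l: Vector_Spaces.linear scale scale "\<lambda>a. br a y" by (rule linear_br_left)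
  show "br (a + b) y = br a y + br b y" "br (c *s a) y = c *s br a y"
    "br (sum g A) y = (\<Sum>i\<in>A. br (g i) y)" "br 0 y = 0" "br (- a) y = - br a y"
    "br (a - b) y = br a y - br b y"
    by (rule l.add l.scale l.sum l.zero l.neg l.diff)+
qed

lemma br_add_right: "br y (a + b) = br y a + br y b"
  and br_scale_right: "br y (c *s a) = c *s br y a"
  and br_sum_right: "br y (sum g A) = (\<Sum>i\<in>A. br y (g i))"
  and br_zero_right: "br y 0 = 0"
  and br_minus_right: "br y (- a) = - br y a"
  and br_diff_right: "br y (a - b) = br y a - br y b"
proof -
  interpret l: Vector_Spaces.linear scale scale "\<lambda>a. br y a" by (rule linear_br_right)
  show "br y (a + b) = br y a + br y b" "br y (c *s a) = c *s br y a"
    "br y (sum g A) = (\<Sum>i\<in>A. br y (g i))" "br y 0 = 0" "br y (- a) = - br y a"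
    "br y (a - b) = br y a - br y b"
    by (rule l.add l.scale l.sum l.zero l.neg l.diff)+
qed

lemmas br_linear =
  br_add_left br_scale_left br_zero_left br_minus_left br_diff_left
  br_add_right br_scale_right br_zero_right br_minus_right br_diff_right

lemma right_mult_derivation: "br (br y z) w = br (br y w) z + br y (br z w)"
  using right_leibniz[of y z w] by (simp add: algebra_simps)

text \<open>Both terms expand to the same difference with opposite signs. So a left multiplication is minus
the corresponding right multiplication, up to elements that every left multiplication kills.\<close>

lemma br_symmetrized_right: "br w (br y z + br z y) = 0"
  by (simp add: br_add_right right_leibniz)

lemma br_square_right: "br w (br y y) = 0"
  by (simp add: right_leibniz)

text \<open>Named so that simplification treats a combination as one term instead of splitting the sum.\<close>

definition lincomb :: "(nat \<Rightarrow> 'a) \<Rightarrow> nat set \<Rightarrow> (nat \<Rightarrow> complex) \<Rightarrow> 'a" where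
  "lincomb b I c = (\<Sum>i\<in>I. c i *s b i)"

lemma lincomb_add: "lincomb b I c + lincomb b I d = lincomb b I (\<lambda>i. c i + d i)"
  by (simp add: lincomb_def scale_left_distrib sum.distrib)

lemma lincomb_diff: "lincomb b I c - lincomb b I d = lincomb b I (\<lambda>i. c i - d i)"
  by (simp add: lincomb_def scale_left_diff_distrib sum_subtractf)

lemma lincomb_minus: "- lincomb b I c = lincomb b I (\<lambda>i. - c i)"
  by (simp add: lincomb_def sum_negf)

lemma lincomb_scale: "a *s lincomb b I c = lincomb b I (\<lambda>i. a * c i)"
  by (simp add: lincomb_def scale_sum_right)

lemma lincomb_cong:
  "I = J \<Longrightarrow> (\<And>i. i \<in> J \<Longrightarrow> c i *s b i = d i *s b' i) \<Longrightarrow> lincomb b I c = lincomb b' J d"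
  by (simp add: lincomb_def)

lemma br_lincomb_left: "br (lincomb b I c) y = lincomb (\<lambda>i. br (b i) y) I c"
  by (simp add: lincomb_def br_sum_left br_scale_left)

lemma br_lincomb_right: "br y (lincomb b I c) = lincomb (\<lambda>i. br y (b i)) I c"
  by (simp add: lincomb_def br_sum_right br_scale_right)

lemma lincomb_vec_zero: "(\<And>i. i \<in> I \<Longrightarrow> b i = 0) \<Longrightarrow> lincomb b I c = 0"
  by (simp add: lincomb_def)

lemma lincomb_coeff_zero: "(\<And>i. i \<in> I \<Longrightarrow> c i = 0) \<Longrightarrow> lincomb b I c = 0"
  by (simp add: lincomb_def)

lemma lincomb_vec_add: "lincomb (\<lambda>i. b i + b' i) I c = lincomb b I c + lincomb b' I c"
  by (simp add: lincomb_def scale_right_distrib sum.distrib)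

lemma lincomb_vec_minus: "lincomb (\<lambda>i. - b i) I c = - lincomb b I c"
  by (simp add: lincomb_def sum_negf)

lemma lincomb_vec_scale: "lincomb (\<lambda>i. a *s b i) I c = a *s lincomb b I c"
  by (simp add: lincomb_def scale_sum_right mult.commute)

lemma lincomb_extend:
  assumes "finite J" "I \<subseteq> J"
  shows "lincomb b I c = lincomb b J (\<lambda>i. if i \<in> I then c i else 0)"
  unfolding lincomb_def
  by (rule sum.mono_neutral_cong_left) (use assms in auto)

lemma lincomb_single: "lincomb b {i} c = c i *s b i"
  by (simp add: lincomb_def)

lemma lincomb_delta:
  assumes "finite I" "i \<in> I"
  shows "lincomb b I (\<lambda>j. if j = i then c else 0) = c *s b i"
  using assms by (simp add: lincomb_def if_distrib[of "\<lambda>c. c *s _"] sum.delta cong: if_cong)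

lemma lincomb_split_first:
  "p \<le> q \<Longrightarrow> lincomb b {p..q} c = c p *s b p + lincomb b {Suc p..q} c"
  by (simp add: lincomb_def sum.atLeast_Suc_atMost)

lemma lincomb_split_last:
  assumes "p \<le> q" "1 \<le> q"
  shows "lincomb b {p..q} c = lincomb b {p..q - 1} c + c q *s b q"
proof -
  have "{p..q} = insert q {p..q - 1}" using assms by auto
  then show ?thesis using assms by (simp add: lincomb_def add.commute)
qed

lemma lincomb_mem: "subspace V \<Longrightarrow> (\<And>i. i \<in> I \<Longrightarrow> b i \<in> V) \<Longrightarrow> lincomb b I c \<in> V"
  unfolding lincomb_def by (intro subspace_sum subspace_scale)

lemma span_family_lincomb:
  assumes "finite I" "y \<in> span (b ` I)"
  obtains c where "y = lincomb b I c"
proof -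
  from assms(2) have "\<exists>c. y = lincomb b I c"
  proof (induction rule: span_induct_alt)
    case base
    then show ?case by (intro exI[of _ "\<lambda>_. 0"]) (simp add: lincomb_def)
  next
    case (step a v y)
    then obtain i c where "v = b i" "i \<in> I" "y = lincomb b I c" by blast
    then have "a *s v + y = lincomb b I (\<lambda>j. (if j = i then a else 0) + c j)"
      using assms(1) by (simp add: lincomb_add[symmetric] lincomb_delta)
    then show ?case by blast
  qed
  with that show ?thesis by blast
qed

text \<open>A spanning list whose length is the (positive) dimension has no room for repetitions or
  relations.\<close>

lemma ordered_basis_of_spanning_list:
  assumes "span (set bs) = UNIV" "dim (UNIV :: 'a set) = length bs"
  shows "ordered_basis UNIV bs"
proof -
  obtain B where B: "B \<subseteq> set bs" "independent B" "set bs \<subseteq> span B"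
    using maximal_independent_subset[of "set bs"] by blast
  have "span B = UNIV"
    using span_mono[OF B(3)] assms(1) by (simp add: span_span top.extremum_unique)
  then have "card B = length bs"
    using dim_eq_card[of B UNIV] B(2) assms(2) by simp
  moreover have "card B \<le> card (set bs)" using B(1) by (simp add: card_mono)
  ultimately have c: "card (set bs) = length bs" and "card B = card (set bs)"
    using card_length[of bs] by auto
  then have "B = set bs" using B(1) by (simp add: card_subset_eq)
  with B c assms show ?thesis by (simp add: ordered_basis_def card_distinct)
qed

end

section \<open>A single Jordan block in coordinates\<close>

text \<open>The image of the \<open>j\<close>-th vector of a family \<open>b\<close> under the Jordan block with eigenvalue 1 and ones
below the diagonal.\<close>

definition jordan_step :: "nat \<Rightarrow> (nat \<Rightarrow> 'b::comm_monoid_add) \<Rightarrow> nat \<Rightarrow> 'b" where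
  "jordan_step k b j = b j + (if j < k then b (Suc j) else 0)"

text \<open>The recursion runs downwards from the last entry, where the successor is absent.\<close>

lemma jordan_step_surj:
  fixes w :: "nat \<Rightarrow> 'b::ab_group_add"
  assumes V: "0 \<in> V" "\<And>a b. a \<in> V \<Longrightarrow> b \<in> V \<Longrightarrow> a - b \<in> V" "\<And>j. j \<in> {1..k} \<Longrightarrow> w j \<in> V"
  obtains u where "\<And>j. j \<in> {1..k} \<Longrightarrow> jordan_step k u j = w j"
    and "\<And>j. j \<in> {1..k} \<Longrightarrow> u j \<in> V"
proof -
  define r where "r = rec_nat 0 (\<lambda>i v. w (k - i) - v)"
  define u where "u j = r (Suc k - j)" for j
  have r: "r 0 = 0" "r (Suc i) = w (k - i) - r i" for i by (simp_all add: r_def)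
  show thesis
  proof
    fix j assume j: "j \<in> {1..k}"
    then have "u j = w j - u (Suc j)"
      using r(2)[of "k - j"] by (simp add: u_def Suc_diff_le)
    moreover have "u (Suc k) = 0" by (simp add: u_def r)
    ultimately show "jordan_step k u j = w j" using j
      by (cases "j = k") (auto simp: jordan_step_def)
  next
    fix j assume j: "j \<in> {1..k}"
    have r_mem: "i \<le> k \<Longrightarrow> r i \<in> V" for i
      by (induction i) (use V in \<open>auto simp: r\<close>)
    have "Suc k - j \<le> k" using j by auto
    then show "u j \<in> V" by (simp only: u_def r_mem)
  qed
qed

text \<open>The effect of the same block on coordinate vectors, see \<open>lincomb_jordan_step\<close>.\<close>

definition jordan_coeff :: "(nat \<Rightarrow> complex) \<Rightarrow> nat \<Rightarrow> complex" where
  "jordan_coeff d i = d i + (if 1 < i then d (i - 1) else 0)"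

text \<open>Forward substitution: the block is triangular with ones on the diagonal.\<close>

lemma jordan_coeff_surj: obtains \<xi> where "\<forall>i\<ge>1. jordan_coeff \<xi> i = \<delta> i"
proof -
  define r where "r = rec_nat 0 (\<lambda>i v. \<delta> (Suc i) - v)"
  have r: "r 0 = 0" "r (Suc i) = \<delta> (Suc i) - r i" for i by (simp_all add: r_def)
  have "jordan_coeff r i = \<delta> i" if "i \<ge> 1" for i
    using that r by (cases i; cases "i = 1") (auto simp: jordan_coeff_def)
  with that show ?thesis by blast
qed

text \<open>The entries below the first row can always be cleared: row \<open>i > 1\<close> determines the coordinate
\<open>i - 1\<close> from the coordinate \<open>i\<close>, because the subdiagonal entry is 1. The remainder in the first row
is \<open>b\<close>. The argument does not look at the diagonal entry \<open>1 + c\<close>, which may vanish.\<close>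

lemma jordan_cokernel:
  obtains \<rho> b where "\<forall>i\<in>{1..k}. \<beta> i + (jordan_coeff \<rho> i + c * \<rho> i) = (if i = 1 then b else 0)"
proof -
  define r where "r = rec_nat 0 (\<lambda>i v. - \<beta> (k - i) - (c + 1) * v)"
  define \<rho> where "\<rho> j = r (k - j)" for j
  have r: "r (Suc i) = - \<beta> (k - i) - (c + 1) * r i" for i by (simp add: r_def)
  have "\<beta> i + (jordan_coeff \<rho> i + c * \<rho> i) = 0" if "i \<in> {1..k}" "i \<noteq> 1" for i
  proof -
    have "k - (i - 1) = Suc (k - i)" using that by auto
    then have "\<rho> (i - 1) = - \<beta> i - (c + 1) * \<rho> i"
      using that by (simp add: \<rho>_def r)
    then show ?thesis using that by (simp add: jordan_coeff_def algebra_simps)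
  qed
  then show ?thesis
    by (intro that[of \<rho> "\<beta> 1 + (jordan_coeff \<rho> 1 + c * \<rho> 1)"]) auto
qed

lemma (in leibniz_algebra) lincomb_jordan_step:
  "lincomb (jordan_step k b) {1..k} d = lincomb b {1..k} (jordan_coeff d)"
proof -
  have "(\<Sum>j=1..k. d j *s (if j < k then b (Suc j) else 0)) = (\<Sum>j\<in>{1..<k}. d j *s b (Suc j))"
    by (rule sum.mono_neutral_cong_right) auto
  also have "\<dots> = (\<Sum>i\<in>{2..<Suc k}. d (i - 1) *s b i)"
    using sum.shift_bounds_Suc_ivl[of "\<lambda>i. d (i - 1) *s b i" 1 k] by (simp add: numeral_2_eq_2)
  also have "\<dots> = (\<Sum>i=1..k. (if 1 < i then d (i - 1) else 0) *s b i)"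
    by (rule sum.mono_neutral_cong_left) auto
  finally show ?thesis
    by (simp add: lincomb_def jordan_step_def jordan_coeff_def scale_right_distrib
        scale_left_distrib sum.distrib)
qed

section \<open>One-dimensional extensions with an adapted basis\<close>

text \<open>The ideal in the basis where \<open>e 1\<close> has square zero, with an element \<open>x\<close> acting on the span of
\<open>f 1, \<dots>, f k\<close> by the Jordan block with eigenvalue 1 modulo the other basis vectors. The conditions are
only about spans, and linear independence follows by counting dimensions; a change of basis then
has to preserve spans and products only.\<close>

locale mu3_frame = leibniz_algebra scale br
  for scale :: "complex \<Rightarrow> 'a::ab_group_add \<Rightarrow> 'a" (infixr "*s" 75) and br +
  fixes m k :: nat and N :: "'a set" and e f :: "nat \<Rightarrow> 'a" and x :: 'a
  assumes m5: "5 \<le> m" and k1: "1 \<le> k"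
    and ideal: "two_sided_ideal N"
    and span_N: "span (e ` {1..m} \<union> f ` {1..2 * k}) = N"
    and span_x: "span (insert x N) = UNIV"
    and dim: "dim (UNIV :: 'a set) = m + 2 * k + 1"
    and ee: "\<And>i j. i \<in> {1..m} \<Longrightarrow> j \<in> {1..m} \<Longrightarrow>
      br (e i) (e j) = (if 2 \<le> i \<and> i \<le> m - 1 \<and> j = 1 then e (i + 1) else 0)"
    and ef: "\<And>i j. i \<in> {1..m} \<Longrightarrow> j \<in> {1..2 * k} \<Longrightarrow>
      br (e i) (f j) = (if i = 2 \<and> j \<le> k then f (k + j) else 0)"
    and fe: "\<And>i j. i \<in> {1..2 * k} \<Longrightarrow> j \<in> {1..m} \<Longrightarrow> br (f i) (e j) = 0"
    and ff: "\<And>i j. i \<in> {1..2 * k} \<Longrightarrow> j \<in> {1..2 * k} \<Longrightarrow> br (f i) (f j) = 0"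
    and fx: "\<And>j. j \<in> {1..k} \<Longrightarrow>
      br (f j) x - jordan_step k f j \<in> span (e ` {1..m} \<union> f ` {k + 1..2 * k})"
begin

abbreviation g :: "nat \<Rightarrow> 'a" where "g j \<equiv> f (k + j)"

abbreviation comb :: "(nat \<Rightarrow> complex) \<Rightarrow> (nat \<Rightarrow> complex) \<Rightarrow> (nat \<Rightarrow> complex) \<Rightarrow> 'a" where
  "comb c d d' \<equiv> lincomb e {1..m} c + lincomb f {1..k} d + lincomb g {1..k} d'"

lemma subspace_N: "subspace N"
  using ideal by (simp add: two_sided_ideal_def)

lemma br_N: "y \<in> N \<Longrightarrow> br y w \<in> N" "y \<in> N \<Longrightarrow> br w y \<in> N"
  using ideal by (simp_all add: two_sided_ideal_def)

lemma e_in_N: "i \<in> {1..m} \<Longrightarrow> e i \<in> N"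
  and f_in_N: "j \<in> {1..2 * k} \<Longrightarrow> f j \<in> N"
  using span_base[of _ "e ` {1..m} \<union> f ` {1..2 * k}"] span_N by auto

lemma fk_in_N: "j \<in> {1..k} \<Longrightarrow> f j \<in> N" and g_in_N: "j \<in> {1..k} \<Longrightarrow> g j \<in> N"
  by (auto intro: f_in_N)

lemma f_image_split: "f ` {1..2 * k} = f ` {1..k} \<union> g ` {1..k}"
proof -
  have "{1..2 * k} = {1..k} \<union> (\<lambda>j. k + j) ` {1..k}"
    using image_add_atLeastAtMost[of k 1 k] by (auto simp: mult_2)
  then show ?thesis by (simp only: image_Un image_image)
qed

lemma g_image: "f ` {k + 1..2 * k} = g ` {1..k}"
proof -
  have "{k + 1..2 * k} = (\<lambda>j. k + j) ` {1..k}"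
    using image_add_atLeastAtMost[of k 1 k] by (simp add: mult_2)
  then show ?thesis by (simp only: image_image)
qed

lemma frame_list_spans:
  "span (set (map e [1..<m + 1] @ map f [1..<2 * k + 1] @ [x])) = UNIV"
proof -
  have "set (map e [1..<m + 1] @ map f [1..<2 * k + 1] @ [x])
      = insert x (e ` {1..m} \<union> f ` {1..2 * k})" (is "?L = ?R")
    by (auto simp: atLeastLessThanSuc_atLeastAtMost)
  moreover have "span (insert x N) \<subseteq> span ?R"
  proof (rule span_minimal)
    have "N \<subseteq> span ?R"
      using span_mono[of "e ` {1..m} \<union> f ` {1..2 * k}" ?R] span_N by blast
    then show "insert x N \<subseteq> span ?R" by (simp add: span_base)
  qed simp
  ultimately show ?thesis using span_x by auto
qed

lemma frame_list_basis: "ordered_basis UNIV (map e [1..<m + 1] @ map f [1..<2 * k + 1] @ [x])"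
  by (rule ordered_basis_of_spanning_list[OF frame_list_spans]) (simp add: dim)

text \<open>The basis is indexed by a disjoint sum, so that independence of a set, together with the count of
its elements, yields independence of the indexed family.\<close>

lemma comb_eq_0:
  assumes "comb c d d' = 0"
  shows "(\<forall>i\<in>{1..m}. c i = 0) \<and> (\<forall>j\<in>{1..k}. d j = 0) \<and> (\<forall>j\<in>{1..k}. d' j = 0)"
proof -
  define b where "b = case_sum e (case_sum f g)"
  define I where "I = {1..m} <+> ({1..k} <+> {1..k})"
  define u where "u = case_sum c (case_sum d d')"
  have fin: "finite I" by (simp add: I_def)
  have im: "b ` I = e ` {1..m} \<union> f ` {1..2 * k}"
    unfolding f_image_split by (simp add: b_def I_def Plus_def image_Un image_image)
  have bas: "distinct (map e [1..<m + 1] @ map f [1..<2 * k + 1] @ [x])"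
    "independent (set (map e [1..<m + 1] @ map f [1..<2 * k + 1] @ [x]))"
    using frame_list_basis unfolding ordered_basis_def by blast+
  have "b ` I \<subseteq> set (map e [1..<m + 1] @ map f [1..<2 * k + 1] @ [x])"
    unfolding im by (auto simp: atLeastLessThanSuc_atLeastAtMost)
  then have indep: "independent (b ` I)" using bas(2) independent_mono by blast
  have "distinct (map e [1..<m + 1] @ map f [1..<2 * k + 1])" using bas(1) by simp
  then have "card (set (map e [1..<m + 1] @ map f [1..<2 * k + 1])) = m + 2 * k"
    by (subst distinct_card) auto
  moreover have "set (map e [1..<m + 1] @ map f [1..<2 * k + 1]) = b ` I"
    unfolding im by (auto simp: atLeastLessThanSuc_atLeastAtMost)
  moreover have "card I = m + 2 * k" by (simp add: I_def card_Plus)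
  ultimately have "inj_on b I" using fin by (simp add: eq_card_imp_inj_on)
  define v where "v = (\<lambda>y. u (inv_into I b y))"
  have "(\<Sum>y\<in>b ` I. v y *s y) = (\<Sum>i\<in>I. u i *s b i)"
    using \<open>inj_on b I\<close> by (simp add: sum.reindex v_def)
  also have "\<dots> = comb c d d'"
    by (simp add: I_def sum.Plus u_def b_def lincomb_def comp_def add.assoc)
  finally have "(\<Sum>y\<in>b ` I. v y *s y) = 0" using assms by simp
  then have "v (b i) = 0" if "i \<in> I" for i
    using independentD[OF indep, of "b ` I" v] fin that by blast
  then have *: "u i = 0" if "i \<in> I" for i
    using \<open>inj_on b I\<close> that by (simp add: v_def)
  show ?thesis
    using *[of "Inl _"] *[of "Inr (Inl _)"] *[of "Inr (Inr _)"] by (auto simp: I_def u_def)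
qed

lemma comb_sub_eq_0:
  assumes "lincomb e A c + lincomb f B d + lincomb g C d' = 0"
    and "A \<subseteq> {1..m}" "B \<subseteq> {1..k}" "C \<subseteq> {1..k}"
  shows "\<And>i. i \<in> A \<Longrightarrow> c i = 0" "\<And>j. j \<in> B \<Longrightarrow> d j = 0" "\<And>j. j \<in> C \<Longrightarrow> d' j = 0"
proof -
  have "comb (\<lambda>i. if i \<in> A then c i else 0) (\<lambda>i. if i \<in> B then d i else 0)
      (\<lambda>i. if i \<in> C then d' i else 0) = 0"
    using assms by (simp add: lincomb_extend[symmetric])
  from comb_eq_0[OF this] assms(2-4)
  show "\<And>i. i \<in> A \<Longrightarrow> c i = 0" "\<And>j. j \<in> B \<Longrightarrow> d j = 0" "\<And>j. j \<in> C \<Longrightarrow> d' j = 0"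
    by (meson subsetD)+
qed

lemma N_coordinates:
  assumes "y \<in> N"
  obtains c d d' where "y = comb c d d'"
proof -
  from assms have "y \<in> span ((e ` {1..m} \<union> f ` {1..k}) \<union> g ` {1..k})"
    using span_N f_image_split by (simp add: Un_assoc)
  then obtain y1 y2 y3 where "y = y1 + y2 + y3"
    "y1 \<in> span (e ` {1..m})" "y2 \<in> span (f ` {1..k})" "y3 \<in> span (g ` {1..k})"
    unfolding span_Un by blast
  with that show ?thesis by (metis span_family_lincomb finite_atLeastAtMost)
qed

lemma lincomb_e_in_N: "A \<subseteq> {1..m} \<Longrightarrow> lincomb e A c \<in> N"
  by (rule lincomb_mem[OF subspace_N]) (auto intro!: e_in_N)

subsection \<open>Products inside the ideal\<close>

lemma br_N_right_zeroI:
  assumes "\<And>i. i \<in> {1..m} \<Longrightarrow> br w (e i) = 0" "\<And>j. j \<in> {1..2 * k} \<Longrightarrow> br w (f j) = 0"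
    and "y \<in> N"
  shows "br w y = 0"
proof -
  have "y \<in> span (e ` {1..m} \<union> f ` {1..2 * k})" using assms(3) span_N by simp
  then show ?thesis
    by (induction rule: span_induct_alt) (use assms(1,2) in \<open>auto simp: br_linear\<close>)
qed

lemma br_N_left_zeroI:
  assumes "\<And>i. i \<in> {1..m} \<Longrightarrow> br (e i) w = 0" "\<And>j. j \<in> {1..2 * k} \<Longrightarrow> br (f j) w = 0"
    and "y \<in> N"
  shows "br y w = 0"
proof -
  have "y \<in> span (e ` {1..m} \<union> f ` {1..2 * k})" using assms(3) span_N by simp
  then show ?thesis
    by (induction rule: span_induct_alt) (use assms(1,2) in \<open>auto simp: br_linear\<close>)
qed

lemma e1_left_zero: "y \<in> N \<Longrightarrow> br (e 1) y = 0"
  by (rule br_N_right_zeroI) (use m5 in \<open>auto simp: ee ef\<close>)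

lemma f_left_zero: "j \<in> {1..2 * k} \<Longrightarrow> y \<in> N \<Longrightarrow> br (f j) y = 0"
  by (rule br_N_right_zeroI) (auto simp: fe ff)

lemma em_left_zero: "y \<in> N \<Longrightarrow> br (e m) y = 0"
  by (rule br_N_right_zeroI) (use m5 in \<open>auto simp: ee ef\<close>)

lemma e_right_zero: "i \<in> {2..m} \<Longrightarrow> y \<in> N \<Longrightarrow> br y (e i) = 0"
  by (rule br_N_left_zeroI) (auto simp: ee fe)

lemma g_right_zero: "j \<in> {1..k} \<Longrightarrow> y \<in> N \<Longrightarrow> br y (g j) = 0"
  by (rule br_N_left_zeroI) (auto simp: ef ff)

lemma e_shift: "2 \<le> p \<Longrightarrow> br (lincomb e {p..m} c) (e 1) = lincomb e {Suc p..m} (\<lambda>i. c (i - 1))"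
proof (cases "p \<le> m")
  case True
  assume p: "2 \<le> p"
  have "{p..m} = insert m {p..<m}" using True by auto
  then have "br (lincomb e {p..m} c) (e 1) = (\<Sum>i\<in>{p..<m}. c i *s br (e i) (e 1)) + c m *s br (e m) (e 1)"
    by (simp add: br_lincomb_left) (simp add: lincomb_def add.commute)
  also have "br (e m) (e 1) = 0" using m5 by (auto simp: ee)
  also have "(\<Sum>i\<in>{p..<m}. c i *s br (e i) (e 1)) = (\<Sum>i\<in>{p..<m}. c i *s e (Suc i))"
    using p m5 by (intro sum.cong) (auto simp: ee)
  also have "\<dots> = (\<Sum>i\<in>{Suc p..<Suc m}. c (i - 1) *s e i)"
    by (subst sum.shift_bounds_Suc_ivl) simp
  finally show ?thesis by (simp add: lincomb_def atLeastLessThanSuc_atLeastAtMost)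
qed (simp add: lincomb_def br_zero_left)

lemma lincomb_e_split: "lincomb e {1..m} c = c 1 *s e 1 + lincomb e {2..m} c"
  using lincomb_split_first[of 1 m e c] m5 by (simp add: numeral_2_eq_2)

lemma comb_br_e1: "br (comb c d d') (e 1) = lincomb e {3..m} (\<lambda>i. c (i - 1))"
proof -
  have "br (e 1) (e 1) = 0" using m5 by (simp add: ee)
  moreover have "br (lincomb f {1..k} d) (e 1) = 0" "br (lincomb g {1..k} d') (e 1) = 0"
    unfolding br_lincomb_left by (rule lincomb_vec_zero, use m5 in \<open>auto simp: fe\<close>)+
  ultimately show ?thesis
    using e_shift[of 2 c] unfolding lincomb_e_split br_add_left br_scale_left by simp
qed

lemma comb_br_f:
  assumes "j \<in> {1..k}"
  shows "br (comb c d d') (f j) = c 2 *s g j"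
proof -
  have "br (lincomb e {1..m} c) (f j) = (\<Sum>i\<in>{1..m}. if i = 2 then c 2 *s g j else 0)"
    unfolding lincomb_def br_sum_left br_scale_left using assms by (intro sum.cong) (auto simp: ef)
  then have "br (lincomb e {1..m} c) (f j) = c 2 *s g j" using m5 by simp
  moreover have "br (lincomb f {1..k} d) (f j) = 0" "br (lincomb g {1..k} d') (f j) = 0"
    unfolding br_lincomb_left by (rule lincomb_vec_zero, use assms in \<open>auto simp: ff\<close>)+
  ultimately show ?thesis unfolding br_add_left by simp
qed

lemma e2_br_comb: "br (e 2) (comb c d d') = c 1 *s e 3 + lincomb g {1..k} d"
proof -
  have "br (e 2) (lincomb e {2..m} c) = 0" "br (e 2) (lincomb g {1..k} d') = 0"
    unfolding br_lincomb_right by (rule lincomb_vec_zero, use m5 in \<open>auto simp: ee ef\<close>)+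
  moreover have "br (e 2) (lincomb f {1..k} d) = lincomb g {1..k} d"
    unfolding br_lincomb_right using m5 by (intro lincomb_cong) (auto simp: ef)
  moreover have "br (e 2) (e 1) = e 3" using m5 by (auto simp: ee)
  ultimately show ?thesis
    unfolding lincomb_e_split br_add_right br_scale_right by simp
qed

lemma e_br_comb:
  assumes "i \<in> {3..m - 1}"
  shows "br (e i) (comb c d d') = c 1 *s e (Suc i)"
proof -
  have "br (e i) (lincomb e {2..m} c) = 0" "br (e i) (lincomb g {1..k} d') = 0"
    "br (e i) (lincomb f {1..k} d) = 0"
    unfolding br_lincomb_right by (rule lincomb_vec_zero, use m5 assms in \<open>auto simp: ee ef\<close>)+
  moreover have "br (e i) (e 1) = e (Suc i)" using assms m5 by (auto simp: ee)
  ultimately show ?thesis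
    unfolding lincomb_e_split br_add_right br_scale_right by simp
qed

subsection \<open>Elements killed by left multiplications\<close>

text \<open>For \<open>i \<ge> 3\<close> the vector \<open>e i\<close> is a symmetrized product, since \<open>[e 1, e (i - 1)] = 0\<close>.\<close>

lemma x_e_zero:
  assumes "i \<in> {3..m}"
  shows "br w (e i) = 0"
proof -
  obtain i' where i': "i = Suc i'" "i' \<in> {2..m - 1}" using assms by (cases i) auto
  then have "br (e i') (e 1) = e i" "br (e 1) (e i') = 0" using m5 by (auto simp: ee)
  then have "br (e (i - 1)) (e 1) + br (e 1) (e (i - 1)) = e i" by (simp add: i')
  then show ?thesis using br_symmetrized_right[of w "e (i - 1)" "e 1"] by simp
qed

lemma x_g_zero:
  assumes "j \<in> {1..k}"
  shows "br w (g j) = 0"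
proof -
  have "br (e 2) (f j) + br (f j) (e 2) = g j" using assms m5 by (auto simp: ef fe)
  then show ?thesis using br_symmetrized_right[of w "e 2" "f j"] by simp
qed

text \<open>Modulo the ideal \<open>[x, x]\<close> is \<open>c x\<close>, and \<open>[x, [x, x]] = 0\<close> forces \<open>c [x, x]\<close> into the ideal.\<close>

lemma xx_in_N: "br x x \<in> N"
proof -
  have "span N = N" using subspace_N by (simp only: span_eq_iff)
  then obtain c where c: "br x x - c *s x \<in> N"
    using span_x span_breakdown_eq[of "br x x" x N] by (metis UNIV_I)
  show ?thesis
  proof (cases "c = 0")
    case False
    have "br x (br x x - c *s x) \<in> N" using c by (rule br_N)
    then have "- c *s br x x \<in> N" by (simp add: br_linear br_square_right)
    then have "(- inverse c) *s (- c *s br x x) \<in> N" using subspace_N subspace_scale by blast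
    then show ?thesis using False by simp
  qed (use c in simp)
qed

text \<open>Left multiplication by \<open>e 2\<close> detects the coordinates at \<open>e 1\<close> and at \<open>f 1, \<dots>, f k\<close>. In particular
this applies to symmetrized products and squares.\<close>

lemma annihilator_coordinates:
  assumes "z \<in> N" "br (e 2) z = 0"
  obtains c d' where "z = lincomb e {2..m} c + lincomb g {1..k} d'"
proof -
  obtain c d d' where z: "z = comb c d d'" using N_coordinates assms(1) by blast
  have "lincomb e {3} (\<lambda>_. c 1) + lincomb f {} d + lincomb g {1..k} d = 0"
    using assms(2) unfolding z e2_br_comb by (simp add: lincomb_def)
  from comb_sub_eq_0[OF this] m5 have "c 1 = 0" "\<And>j. j \<in> {1..k} \<Longrightarrow> d j = 0" by auto
  moreover from this have "lincomb f {1..k} d = 0" by (intro lincomb_coeff_zero)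
  ultimately have "z = lincomb e {2..m} c + lincomb g {1..k} d'"
    unfolding z lincomb_e_split by simp
  with that show ?thesis by blast
qed

end

section \<open>The shape of the two multiplications by the outer element\<close>

context mu3_frame
begin

lemma e_top:
  assumes "\<And>i. i \<in> {2..m - 1} \<Longrightarrow> c i = 0"
  shows "lincomb e {2..m} c = c m *s e m"
proof -
  have "lincomb e {2..m - 1} c = 0" using assms by (rule lincomb_coeff_zero)
  then show ?thesis using lincomb_split_last[of 2 m e c] m5 by simp
qed

text \<open>Right multiplication by \<open>e 1\<close> shifts the \<open>e\<close>-coordinates and forgets only the last one.\<close>

lemma shifted_coeffs_zero:
  assumes "lincomb e {3..m} (\<lambda>i. c (i - 1)) + v *s g j = 0" "j \<in> {1..k}"
  shows "lincomb e {2..m} c = c m *s e m" and "v = 0"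
proof -
  have *: "lincomb e {3..m} (\<lambda>i. c (i - 1)) + lincomb f {} (\<lambda>_. 0) + lincomb g {j} (\<lambda>_. v) = 0"
    using assms(1) by (simp add: lincomb_def)
  show "lincomb e {2..m} c = c m *s e m"
  proof (rule e_top)
    fix i assume "i \<in> {2..m - 1}"
    then have "Suc i \<in> {3..m}" by auto
    then show "c i = 0" using comb_sub_eq_0(1)[OF *, of "Suc i"] assms(2) by auto
  qed
  show "v = 0" using comb_sub_eq_0(3)[OF *, of j] assms(2) by auto
qed

lemma tail_br_e1: "2 \<le> p \<Longrightarrow> br (lincomb e {p..m} c + lincomb g {1..k} d') (e 1) = lincomb e {Suc p..m} (\<lambda>i. c (i - 1))"
proof -
  have "br (lincomb g {1..k} d') (e 1) = 0"
    unfolding br_lincomb_left by (rule lincomb_vec_zero, use m5 in \<open>auto simp: fe\<close>)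
  then show "2 \<le> p \<Longrightarrow> ?thesis" using e_shift by (simp add: br_add_left)
qed

lemma tail_br_f:
  assumes "j \<in> {1..k}"
  shows "br (lincomb e {2..m} c + lincomb g {1..k} d') (f j) = c 2 *s g j"
proof -
  have "br (e 1) (f j) = 0" using assms by (intro e1_left_zero f_in_N) auto
  moreover have "br (lincomb f {1..k} (\<lambda>_. 0)) (f j) = 0"
    by (simp add: lincomb_def br_zero_left)
  ultimately show ?thesis using comb_br_f[OF assms, of c "\<lambda>_. 0" d']
    unfolding lincomb_e_split br_add_left br_scale_left by simp
qed

lemma f_span_left_zero: "y \<in> N \<Longrightarrow> br (lincomb f {1..k} d) y = 0"
  unfolding br_lincomb_left by (rule lincomb_vec_zero) (auto intro: f_left_zero)

lemma f_step_left_zero: "j \<in> {1..k} \<Longrightarrow> y \<in> N \<Longrightarrow> br (jordan_step k f j) y = 0"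
  by (auto simp: jordan_step_def br_linear f_left_zero)

text \<open>Apply the derivation to \<open>[e 1, e 1] = 0\<close>.\<close>

lemma right_e1:
  obtains a am \<beta> \<beta>' where
    "br (e 1) x = a *s e 1 + am *s e m + lincomb f {1..k} \<beta> + lincomb g {1..k} \<beta>'"
proof -
  have N: "br (e 1) x \<in> N" using m5 by (intro br_N e_in_N) auto
  then obtain c d d' where c: "br (e 1) x = comb c d d'" by (rule N_coordinates)
  have "br (br (e 1) (e 1)) x = 0" using m5 by (simp add: ee br_zero_left)
  then have "br (br (e 1) x) (e 1) = 0"
    using right_mult_derivation[of "e 1" "e 1" x] e1_left_zero[OF N] by simp
  then have "lincomb e {3..m} (\<lambda>i. c (i - 1)) + 0 *s g 1 = 0"
    unfolding c comb_br_e1 by simp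
  from shifted_coeffs_zero(1)[OF this] k1 have "lincomb e {2..m} c = c m *s e m" by simp
  with c have "br (e 1) x = c 1 *s e 1 + c m *s e m + lincomb f {1..k} d + lincomb g {1..k} d'"
    unfolding lincomb_e_split by simp
  with that show ?thesis by blast
qed

text \<open>Apply the derivation to \<open>[e 2, e 2] = 0\<close>.\<close>

lemma right_e2:
  obtains \<gamma> \<delta> where "br (e 2) x = lincomb e {2..m} \<gamma> + lincomb g {1..k} \<delta>"
proof -
  have N: "br (e 2) x \<in> N" using m5 by (intro br_N e_in_N) auto
  have "br (br (e 2) (e 2)) x = 0" using m5 by (simp add: ee br_zero_left)
  moreover have "br (br (e 2) x) (e 2) = 0" using N m5 by (intro e_right_zero) auto
  ultimately have "br (e 2) (br (e 2) x) = 0"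
    using right_mult_derivation[of "e 2" "e 2" x] by simp
  with N annihilator_coordinates that show ?thesis by blast
qed

text \<open>Apply the derivation to \<open>[f j, e 1] = 0\<close> for the coordinates at \<open>e 2, \<dots>, e (m - 1)\<close> and to
\<open>[e 3, f j] = 0\<close> for the coordinate at \<open>e 1\<close>.\<close>

lemma right_f:
  assumes j: "j \<in> {1..k}"
  obtains \<phi> s where "br (f j) x = jordan_step k f j + \<phi> *s e m + lincomb g {1..k} s"
proof -
  define v where "v = br (f j) x - jordan_step k f j"
  have "v \<in> span (e ` {1..m} \<union> g ` {1..k})" using fx[OF j] by (simp only: g_image v_def)
  then obtain v1 v2 where "v = v1 + v2" "v1 \<in> span (e ` {1..m})" "v2 \<in> span (g ` {1..k})"
    unfolding span_Un by blast
  then obtain c s where v: "v = lincomb e {1..m} c + lincomb g {1..k} s"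
    by (metis span_family_lincomb finite_atLeastAtMost)
  then have vc: "v = comb c (\<lambda>_. 0) s" by (simp add: lincomb_def)
  have D: "br (f j) x = jordan_step k f j + v" by (simp add: v_def)
  have fN: "f j \<in> N" using j by (auto intro: f_in_N)
  have e1N: "e 1 \<in> N" and e3N: "e 3 \<in> N" using m5 by (auto intro: e_in_N)
  have "br (f j) (e 1) = 0" "br (f j) (br (e 1) x) = 0"
    using j e1N br_N by (auto intro!: f_left_zero)
  then have "br (br (f j) x) (e 1) = 0"
    using right_mult_derivation[of "f j" "e 1" x] by (simp add: br_zero_left)
  then have "br v (e 1) = 0" using f_step_left_zero[OF j e1N] by (simp add: D br_add_left)
  then have "lincomb e {3..m} (\<lambda>i. c (i - 1)) + 0 *s g 1 = 0"
    unfolding vc comb_br_e1 by simp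
  from shifted_coeffs_zero(1)[OF this] k1 have top: "lincomb e {2..m} c = c m *s e m" by simp
  have "br (e 3) x \<in> N" using e3N by (rule br_N)
  then obtain c' d d' where c': "br (e 3) x = comb c' d d'" by (rule N_coordinates)
  have "br (e 3) (f i) = 0" if "i \<in> {1..k}" for i using that m5 by (auto simp: ef)
  then have "br (e 3) (jordan_step k f j) = 0" "br (e 3) (f j) = 0"
    using j by (auto simp: jordan_step_def br_linear)
  then have "br (br (e 3) x) (f j) + br (e 3) v = 0"
    using right_mult_derivation[of "e 3" "f j" x] by (simp add: D br_linear)
  moreover have "br (e 3) v = c 1 *s e 4"
    using e_br_comb[of 3 c "\<lambda>_. 0" s] m5 by (simp add: vc)
  moreover have "br (br (e 3) x) (f j) = c' 2 *s g j" unfolding c' by (rule comb_br_f[OF j])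
  ultimately have "lincomb e {4} (\<lambda>_. c 1) + lincomb f {} (\<lambda>_. 0) + lincomb g {j} (\<lambda>_. c' 2) = 0"
    by (simp add: lincomb_def add.commute)
  from comb_sub_eq_0(1)[OF this, of 4] m5 j have "c 1 = 0" by auto
  then have "v = c m *s e m + lincomb g {1..k} s" unfolding v lincomb_e_split top by simp
  with D that show ?thesis by (simp add: add.assoc)
qed

text \<open>Apply the derivation to \<open>[e 2, f j] = f (k + j)\<close>.\<close>

lemma right_g:
  assumes j: "j \<in> {1..k}" and De2: "br (e 2) x = lincomb e {2..m} \<gamma> + lincomb g {1..k} \<delta>"
  shows "br (g j) x = \<gamma> 2 *s g j + jordan_step k g j"
proof -
  obtain \<phi> s where f: "br (f j) x = jordan_step k f j + \<phi> *s e m + lincomb g {1..k} s"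
    using j by (rule right_f)
  have e2N: "e 2 \<in> N" using m5 by (auto intro: e_in_N)
  have e2f: "br (e 2) (f i) = g i" if "i \<in> {1..k}" for i using that m5 by (auto simp: ef)
  have "br (e 2) (jordan_step k f j) = jordan_step k g j"
    using j by (auto simp: jordan_step_def br_linear e2f)
  moreover have "br (e 2) (e m) = 0" using m5 e2N by (intro e_right_zero) auto
  moreover have "br (e 2) (lincomb g {1..k} s) = 0"
    unfolding br_lincomb_right by (rule lincomb_vec_zero) (rule g_right_zero[OF _ e2N])
  ultimately have "br (e 2) (br (f j) x) = jordan_step k g j"
    unfolding f by (simp add: br_linear)
  then show ?thesis
    using right_mult_derivation[of "e 2" "f j" x] tail_br_f[OF j, of \<gamma> \<delta>]
    by (simp add: e2f[OF j] De2)
qed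

lemma right_e3:
  assumes De1: "br (e 1) x = a *s e 1 + am *s e m + lincomb f {1..k} \<beta> + lincomb g {1..k} \<beta>'"
    and De2: "br (e 2) x = lincomb e {2..m} \<gamma> + lincomb g {1..k} \<delta>"
  shows "br (e 3) x = a *s e 3 + lincomb e {3..m} (\<lambda>i. \<gamma> (i - 1)) + lincomb g {1..k} \<beta>"
proof -
  have e2N: "e 2 \<in> N" using m5 by (auto intro: e_in_N)
  have e21: "br (e 2) (e 1) = e 3" using m5 by (auto simp: ee)
  have "br (br (e 2) x) (e 1) = lincomb e {3..m} (\<lambda>i. \<gamma> (i - 1))"
    unfolding De2 using tail_br_e1[of 2 \<gamma> \<delta>] by simp
  moreover have "br (e 2) (e m) = 0" using m5 e2N by (intro e_right_zero) auto
  moreover have "br (e 2) (lincomb g {1..k} \<beta>') = 0"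
    unfolding br_lincomb_right by (rule lincomb_vec_zero) (rule g_right_zero[OF _ e2N])
  moreover have "br (e 2) (lincomb f {1..k} \<beta>) = lincomb g {1..k} \<beta>"
    unfolding br_lincomb_right using m5 by (intro lincomb_cong) (auto simp: ef)
  ultimately show ?thesis
    using right_mult_derivation[of "e 2" "e 1" x] unfolding De1 br_add_right br_scale_right e21
    by (simp add: algebra_simps)
qed

text \<open>Iterate the derivation on \<open>e (i + 1) = [e i, e 1]\<close>. From \<open>e 4\<close> on only the \<open>e\<close>-coordinates of the
previous value survive right multiplication by \<open>e 1\<close>.\<close>

lemma right_e:
  assumes De1: "br (e 1) x = a *s e 1 + am *s e m + lincomb f {1..k} \<beta> + lincomb g {1..k} \<beta>'"
    and De2: "br (e 2) x = lincomb e {2..m} \<gamma> + lincomb g {1..k} \<delta>"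
    and "4 \<le> i" "i \<le> m"
  shows "br (e i) x = (of_nat (i - 2) * a) *s e i + lincomb e {i..m} (\<lambda>j. \<gamma> (j - i + 2))"
proof -
  have br_De1: "br (e i) (br (e 1) x) = a *s e (Suc i)" if i: "i \<in> {3..m - 1}" for i
  proof -
    have eN: "e i \<in> N" using i by (auto intro: e_in_N)
    have "br (e i) (e m) = 0" using m5 eN by (intro e_right_zero) auto
    moreover have "br (e i) (lincomb g {1..k} \<beta>') = 0"
      unfolding br_lincomb_right by (rule lincomb_vec_zero) (rule g_right_zero[OF _ eN])
    moreover have "br (e i) (lincomb f {1..k} \<beta>) = 0"
      unfolding br_lincomb_right using i by (intro lincomb_vec_zero) (auto simp: ef)
    moreover have "br (e i) (e 1) = e (Suc i)" using i by (auto simp: ee)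
    ultimately show ?thesis unfolding De1 br_add_right br_scale_right by simp
  qed
  show ?thesis
    using assms(3,4)
  proof (induction i rule: dec_induct)
    case base
    have arr: "u + v + u = (u + u) + v" for u v :: 'a by (simp add: ac_simps)
    have idx: "i - 1 - 1 = i - 4 + 2" if "i \<in> {4..m}" for i using that by auto
    have "br (e 3) (e 1) = e 4" using m5 by (auto simp: ee)
    moreover have "br (e 3) (br (e 1) x) = a *s e 4" using br_De1[of 3] m5 by simp
    moreover have "br (br (e 3) x) (e 1) = a *s e 4 + lincomb e {4..m} (\<lambda>i. \<gamma> (i - 1 - 1))"
      unfolding right_e3[OF De1 De2]
      using tail_br_e1[of 3 "\<lambda>i. \<gamma> (i - 1)" \<beta>] \<open>br (e 3) (e 1) = e 4\<close>
      by (simp only: br_add_left br_scale_left add.assoc) simp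
    moreover have "lincomb e {4..m} (\<lambda>i. \<gamma> (i - 1 - 1)) = lincomb e {4..m} (\<lambda>j. \<gamma> (j - 4 + 2))"
      by (rule lincomb_cong[OF refl]) (simp only: idx)
    ultimately have "br (e 4) x = a *s e 4 + lincomb e {4..m} (\<lambda>j. \<gamma> (j - 4 + 2)) + a *s e 4"
      using right_mult_derivation[of "e 3" "e 1" x] by (simp only:)
    then have "br (e 4) x = (a + a) *s e 4 + lincomb e {4..m} (\<lambda>j. \<gamma> (j - 4 + 2))"
      by (simp only: arr scale_left_distrib)
    moreover have "of_nat (4 - 2) * a = a + a" by simp
    ultimately show ?case by (simp only:)
  next
    case (step l)
    have arr': "u + v + w = (w + u) + v" for u v w :: 'a by (simp add: ac_simps)
    have el: "br (e l) (e 1) = e (Suc l)" using step.hyps step.prems by (auto simp: ee)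
    have "br (e l) (br (e 1) x) = a *s e (Suc l)" using step.hyps step.prems by (intro br_De1) auto
    moreover have "br (br (e l) x) (e 1)
        = (of_nat (l - 2) * a) *s e (Suc l) + lincomb e {Suc l..m} (\<lambda>j. \<gamma> (j - 1 - l + 2))"
    proof -
      have IH: "br (e l) x = (of_nat (l - 2) * a) *s e l + lincomb e {l..m} (\<lambda>j. \<gamma> (j - l + 2))"
        by (rule step.IH) (use step.prems in simp)
      have "2 \<le> l" using step.hyps by simp
      note sh = e_shift[OF this]
      show ?thesis by (simp only: IH br_add_left br_scale_left el sh)
    qed
    moreover have "lincomb e {Suc l..m} (\<lambda>j. \<gamma> (j - 1 - l + 2))
        = lincomb e {Suc l..m} (\<lambda>j. \<gamma> (j - Suc l + 2))"
      by (rule lincomb_cong) auto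
    ultimately have "br (e (Suc l)) x = (of_nat (l - 2) * a) *s e (Suc l)
        + lincomb e {Suc l..m} (\<lambda>j. \<gamma> (j - Suc l + 2)) + a *s e (Suc l)"
      using right_mult_derivation[of "e l" "e 1" x] by (simp only: el)
    moreover have "Suc l - 2 = Suc (l - 2)" using step(1) by simp
    ultimately show ?case
      by (simp only: of_nat_Suc distrib_right scale_left_distrib mult_1
          arr'[of "(of_nat (l - 2) * a) *s e (Suc l)" _ "a *s e (Suc l)"])
  qed
qed

text \<open>The sum \<open>[e 1, x] + [x, e 1]\<close> has only coordinates at \<open>e i\<close> with \<open>i \<ge> 2\<close> and \<open>f (k + j)\<close>. The
coordinate of \<open>[x, e 1]\<close> at \<open>e 2\<close> vanishes by the Leibniz identity for \<open>[x, [f 1, e 1]]\<close>.\<close>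

lemma left_e1:
  assumes De1: "br (e 1) x = a *s e 1 + am *s e m + lincomb f {1..k} \<beta> + lincomb g {1..k} \<beta>'"
  obtains p \<theta> where
    "br x (e 1) = - (a *s e 1) - lincomb f {1..k} \<beta> + lincomb e {3..m} p + lincomb g {1..k} \<theta>"
proof -
  have eN: "e 1 \<in> N" using m5 by (auto intro: e_in_N)
  have "br (e 1) x + br x (e 1) \<in> N" using subspace_N eN br_N by (blast intro: subspace_add)
  then obtain c s where z: "br (e 1) x + br x (e 1) = lincomb e {2..m} c + lincomb g {1..k} s"
    using annihilator_coordinates br_symmetrized_right by blast
  have em: "am *s e m = lincomb e {2..m} (\<lambda>i. if i = m then am else 0)"
    using m5 by (simp add: lincomb_delta)
  define p where "p i = c i - (if i = m then am else 0)" for i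
  have "br x (e 1) = lincomb e {2..m} c + lincomb g {1..k} s - br (e 1) x"
    using z by (simp add: algebra_simps)
  also have "\<dots> = - (a *s e 1) - lincomb f {1..k} \<beta> + lincomb e {2..m} p
      + lincomb g {1..k} (\<lambda>i. s i - \<beta>' i)"
    unfolding De1 em p_def lincomb_diff[symmetric] by simp
  finally have x: "br x (e 1) = - (a *s e 1) - lincomb f {1..k} \<beta> + lincomb e {2..m} p
      + lincomb g {1..k} (\<lambda>i. s i - \<beta>' i)" .
  have f1: "1 \<in> {1..k}" and f1N: "f 1 \<in> N" using k1 by (auto intro: f_in_N)
  have "br (br x (e 1)) (f 1) = p 2 *s g 1"
    using tail_br_f[OF f1, of p "\<lambda>i. s i - \<beta>' i"] e1_left_zero[OF f1N] f_span_left_zero[OF f1N]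
    unfolding x br_add_left br_diff_left br_minus_left br_scale_left by simp
  moreover obtain c' d d' where c': "br x (f 1) = comb c' d d'"
    using N_coordinates[OF br_N(2)[OF f1N]] by blast
  moreover have "br (f 1) (e 1) = 0" using f1 eN by (intro f_left_zero) auto
  ultimately have "lincomb e {3..m} (\<lambda>i. c' (i - 1)) + (- p 2) *s g 1 = 0"
    using right_leibniz[of x "f 1" "e 1"] unfolding c' comb_br_e1 by (simp add: br_zero_right)
  then have "p 2 = 0" using shifted_coeffs_zero(2)[OF _ f1] by fastforce
  then have "lincomb e {2..m} p = lincomb e {3..m} p"
    using lincomb_split_first[of 2 m e p] m5 by (simp add: numeral_eq_Suc)
  with x that show ?thesis by metis
qed

text \<open>Here the extra information comes from \<open>[x, [e 2, e 1]] = [x, e 3] = 0\<close>.\<close>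

lemma left_e2:
  obtains q \<eta> where "br x (e 2) = q *s e m + lincomb g {1..k} \<eta>"
proof -
  have eN: "e 2 \<in> N" using m5 by (auto intro: e_in_N)
  obtain \<gamma> \<delta> where De2: "br (e 2) x = lincomb e {2..m} \<gamma> + lincomb g {1..k} \<delta>"
    by (rule right_e2)
  have "br (e 2) x + br x (e 2) \<in> N" using subspace_N eN br_N by (blast intro: subspace_add)
  then obtain c s where z: "br (e 2) x + br x (e 2) = lincomb e {2..m} c + lincomb g {1..k} s"
    using annihilator_coordinates br_symmetrized_right by blast
  have "br x (e 2) = lincomb e {2..m} c + lincomb g {1..k} s - br (e 2) x"
    using z by (simp add: algebra_simps)
  then have x: "br x (e 2) = lincomb e {2..m} (\<lambda>i. c i - \<gamma> i) + lincomb g {1..k} (\<lambda>i. s i - \<delta> i)"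
    unfolding De2 lincomb_diff[symmetric] by simp
  have "br (e 2) (e 1) = e 3" "br x (e 3) = 0" using m5 by (auto simp: ee intro!: x_e_zero)
  moreover have "br (br x (e 1)) (e 2) = 0"
    using m5 by (intro e_right_zero br_N e_in_N) auto
  ultimately have "br (br x (e 2)) (e 1) = 0" using right_leibniz[of x "e 2" "e 1"] by simp
  then have "lincomb e {3..m} (\<lambda>i. c (i - 1) - \<gamma> (i - 1)) + 0 *s g 1 = 0"
    using tail_br_e1[of 2 "\<lambda>i. c i - \<gamma> i" "\<lambda>i. s i - \<delta> i"] by (simp add: x)
  from shifted_coeffs_zero(1)[OF this] k1 x that show ?thesis by simp
qed

text \<open>Here the extra information comes from \<open>[x, [f j, e 1]] = 0\<close>.\<close>

lemma left_f:
  assumes j: "j \<in> {1..k}"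
  obtains r s where "br x (f j) = - jordan_step k f j + r *s e m + lincomb g {1..k} s"
proof -
  have fN: "f j \<in> N" and e1N: "e 1 \<in> N" using j m5 by (auto intro: f_in_N e_in_N)
  obtain \<phi> s' where Df: "br (f j) x = jordan_step k f j + \<phi> *s e m + lincomb g {1..k} s'"
    using j by (rule right_f)
  have "br (f j) x + br x (f j) \<in> N" using subspace_N fN br_N by (blast intro: subspace_add)
  then obtain c s where z: "br (f j) x + br x (f j) = lincomb e {2..m} c + lincomb g {1..k} s"
    using annihilator_coordinates br_symmetrized_right by blast
  have em: "\<phi> *s e m = lincomb e {2..m} (\<lambda>i. if i = m then \<phi> else 0)"
    using m5 by (simp add: lincomb_delta)
  define p where "p i = c i - (if i = m then \<phi> else 0)" for i
  have "br x (f j) = lincomb e {2..m} c + lincomb g {1..k} s - br (f j) x"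
    using z by (simp add: algebra_simps)
  then have x: "br x (f j) = - jordan_step k f j + (lincomb e {2..m} p
      + lincomb g {1..k} (\<lambda>i. s i - s' i))"
    unfolding Df em p_def lincomb_diff[symmetric] by simp
  obtain c' d d' where c': "br x (e 1) = comb c' d d'"
    using N_coordinates[OF br_N(2)[OF e1N]] by blast
  have "br (br x (f j)) (e 1) = lincomb e {3..m} (\<lambda>i. p (i - 1))"
    using tail_br_e1[of 2 p "\<lambda>i. s i - s' i"] f_step_left_zero[OF j e1N]
    by (simp only: x br_add_left br_minus_left) simp
  moreover have "br (br x (e 1)) (f j) = c' 2 *s g j" unfolding c' by (rule comb_br_f[OF j])
  moreover have "br (f j) (e 1) = 0" using j e1N by (intro f_left_zero) auto
  ultimately have "lincomb e {3..m} (\<lambda>i. p (i - 1)) + (- c' 2) *s g j = 0"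
    using right_leibniz[of x "f j" "e 1"] by (simp add: br_zero_right)
  from shifted_coeffs_zero(1)[OF this j] x that show ?thesis by (simp add: add.assoc)
qed

end

section \<open>Normalizing the left multiplication by the outer element\<close>

declare One_nat_def [simp del] \<comment> \<open>keeps \<open>e 1\<close> and \<open>{1..m}\<close> syntactically stable\<close>

context mu3_frame
begin

text \<open>The \<open>f j\<close> multiply the ideal to zero, so \<open>[f j, x]\<close> does not see a change of \<open>x\<close> inside it.\<close>

lemma frame_change_x:
  assumes "y \<in> N"
  shows "mu3_frame scale br m k N e f (x + y)"
proof unfold_locales
  have "y \<in> span (insert (x + y) N)" using assms by (intro span_base) simp
  moreover have "x + y \<in> span (insert (x + y) N)" by (intro span_base) simp
  ultimately have "x + y - y \<in> span (insert (x + y) N)" by (metis span_diff)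
  then have "insert x N \<subseteq> span (insert (x + y) N)" by (auto intro: span_base)
  then have "span (insert x N) \<subseteq> span (insert (x + y) N)" by (rule span_minimal) (rule subspace_span)
  then show "span (insert (x + y) N) = UNIV" using span_x by blast
  show "br (f j) (x + y) - jordan_step k f j \<in> span (e ` {1..m} \<union> f ` {k + 1..2 * k})"
    if "j \<in> {1..k}" for j
    using fx[OF that] f_left_zero[of j y] that assms by (simp add: br_add_right)
qed (fact m5 k1 ideal span_N dim ee ef fe ff)+

end

text \<open>The terms that a change of \<open>x\<close> by a combination of the \<open>e i\<close> can remove are absent.\<close>

definition (in leibniz_algebra) pure_e_action ::
    "nat \<Rightarrow> nat \<Rightarrow> (nat \<Rightarrow> 'a) \<Rightarrow> (nat \<Rightarrow> 'a) \<Rightarrow> 'a \<Rightarrow> bool" where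
  "pure_e_action m k e f x \<longleftrightarrow>
    (\<exists>a \<beta> \<theta>. br x (e 1) =
      a *s e 1 + lincomb f {1..k} \<beta> + lincomb (\<lambda>j. f (k + j)) {1..k} \<theta>) \<and>
    (\<exists>c \<gamma> \<delta>. br (e 2) x =
      c *s e 2 + lincomb e {4..m} \<gamma> + lincomb (\<lambda>j. f (k + j)) {1..k} \<delta>)"

context mu3_frame
begin

lemma lincomb_e_split3: "lincomb e {2..m} \<gamma> = \<gamma> 2 *s e 2 + \<gamma> 3 *s e 3 + lincomb e {4..m} \<gamma>"
proof -
  have "lincomb e {2..m} \<gamma> = \<gamma> 2 *s e 2 + lincomb e {3..m} \<gamma>"
    using lincomb_split_first[of 2 m e \<gamma>] m5 by (simp add: numeral_eq_Suc)
  moreover have "lincomb e {3..m} \<gamma> = \<gamma> 3 *s e 3 + lincomb e {4..m} \<gamma>"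
    using lincomb_split_first[of 3 m e \<gamma>] m5 by (simp add: numeral_eq_Suc)
  ultimately show ?thesis by (simp add: add.assoc)
qed

text \<open>Adding a multiple of \<open>e 1\<close> to \<open>x\<close> changes the coordinate of \<open>[e 2, x]\<close> at \<open>e 3\<close> and not \<open>[x, e 1]\<close>,
whereas adding \<open>e i\<close> with \<open>2 \<le> i < m\<close> changes \<open>[x, e 1]\<close> by \<open>e (i + 1)\<close> and leaves \<open>[e 2, x]\<close> alone.\<close>

lemma pure_e_action_exists:
  obtains y where "y \<in> N" "pure_e_action m k e f (x + y)"
proof -
  obtain a am \<beta> \<beta>' where De1:
    "br (e 1) x = a *s e 1 + am *s e m + lincomb f {1..k} \<beta> + lincomb g {1..k} \<beta>'"
    by (rule right_e1)
  obtain \<gamma> \<delta> where De2: "br (e 2) x = lincomb e {2..m} \<gamma> + lincomb g {1..k} \<delta>"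
    by (rule right_e2)
  obtain p \<theta> where Le1:
    "br x (e 1) = - (a *s e 1) - lincomb f {1..k} \<beta> + lincomb e {3..m} p + lincomb g {1..k} \<theta>"
    using De1 by (rule left_e1)
  (* the coefficient p (m + 1) at e m is harmless, as [e m, e 1] = 0 *)
  define y where "y = - (\<gamma> 3 *s e 1) - lincomb e {2..m} (\<lambda>i. p (i + 1))"
  have e1N: "e 1 \<in> N" and e2N: "e 2 \<in> N" using m5 by (auto intro: e_in_N)
  have "y \<in> N" unfolding y_def
    using subspace_N e1N lincomb_e_in_N[of "{2..m}"]
    by (intro subspace_diff subspace_neg subspace_scale) auto
  have "br (lincomb e {2..m} (\<lambda>i. p (i + 1))) (e 1) = lincomb e {3..m} (\<lambda>i. p (i - 1 + 1))"
    using e_shift[of 2 "\<lambda>i. p (i + 1)"] by simp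
  also have "\<dots> = lincomb e {3..m} p" by (rule lincomb_cong) auto
  finally have "br y (e 1) = - lincomb e {3..m} p"
    using e1_left_zero[OF e1N] by (simp add: y_def br_diff_left br_minus_left br_scale_left)
  then have "br (x + y) (e 1) = (- a) *s e 1 + lincomb f {1..k} (\<lambda>i. - \<beta> i) + lincomb g {1..k} \<theta>"
    by (simp add: br_add_left Le1 lincomb_minus[symmetric])
  moreover have "br (e 2) (lincomb e {2..m} (\<lambda>i. p (i + 1))) = 0"
    unfolding br_lincomb_right by (rule lincomb_vec_zero) (rule e_right_zero[OF _ e2N])
  moreover have "br (e 2) (e 1) = e 3" using m5 by (auto simp: ee)
  ultimately have "br (e 2) (x + y) = \<gamma> 2 *s e 2 + lincomb e {4..m} \<gamma> + lincomb g {1..k} \<delta>"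
    by (simp add: y_def br_linear De2 lincomb_e_split3)
  with \<open>br (x + y) (e 1) = _\<close> have "pure_e_action m k e f (x + y)"
    unfolding pure_e_action_def by blast
  with \<open>y \<in> N\<close> that show ?thesis by blast
qed

subsection \<open>The center of the ideal\<close>

text \<open>These are the elements that annihilate the ideal from both sides.\<close>

definition center_N :: "'a set" where "center_N = span (insert (e m) (g ` {1..k}))"

lemma center_induct:
  assumes "y \<in> center_N" "P 0" "\<And>c a y. a = e m \<or> (\<exists>j\<in>{1..k}. a = g j) \<Longrightarrow> P y \<Longrightarrow> P (c *s a + y)"
  shows "P y"
  using assms(1) unfolding center_N_def by (induction rule: span_induct_alt) (use assms(2,3) in auto)

lemma subspace_center: "subspace center_N"
  by (simp add: center_N_def)

lemma em_in_center: "e m \<in> center_N" and g_in_center: "j \<in> {1..k} \<Longrightarrow> g j \<in> center_N"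
  unfolding center_N_def by (auto intro: span_base)

lemma center_in_N: "y \<in> center_N \<Longrightarrow> y \<in> N"
  by (erule center_induct)
    (use m5 subspace_N in \<open>auto intro!: subspace_add subspace_scale e_in_N f_in_N subspace_0\<close>)

lemma center_right_zero: "y \<in> center_N \<Longrightarrow> br w y = 0"
  by (erule center_induct) (use m5 in \<open>auto simp: br_linear x_e_zero x_g_zero\<close>)

lemma center_left_zero: "y \<in> center_N \<Longrightarrow> z \<in> N \<Longrightarrow> br y z = 0"
  by (erule center_induct) (auto simp: br_linear em_left_zero f_left_zero)

text \<open>A derivation preserves the center; here it can be read off from the known values.\<close>

lemma center_right_x: "y \<in> center_N \<Longrightarrow> br y x \<in> center_N"
proof (erule center_induct)
  show "br 0 x \<in> center_N" by (simp add: br_zero_left subspace_0[OF subspace_center])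
  fix c a y assume a: "a = e m \<or> (\<exists>j\<in>{1..k}. a = g j)" and y: "br y x \<in> center_N"
  obtain b am \<beta> \<beta>' where De1:
    "br (e 1) x = b *s e 1 + am *s e m + lincomb f {1..k} \<beta> + lincomb g {1..k} \<beta>'"
    by (rule right_e1)
  obtain \<gamma> \<delta> where De2: "br (e 2) x = lincomb e {2..m} \<gamma> + lincomb g {1..k} \<delta>"
    by (rule right_e2)
  have "br (e m) x = (of_nat (m - 2) * b) *s e m + \<gamma> 2 *s e m"
    using right_e[OF De1 De2, of m] m5 by (simp add: lincomb_single del: add_2_eq_Suc' add_2_eq_Suc)
  then have "br (e m) x \<in> center_N"
    using em_in_center subspace_center by (auto intro: subspace_add subspace_scale)
  moreover have "br (g j) x \<in> center_N" if "j \<in> {1..k}" for j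
  proof -
    have "jordan_step k g j \<in> center_N"
      using that subspace_center by (auto simp: jordan_step_def intro!: g_in_center subspace_add)
        (metis add_Suc_right g_in_center atLeastAtMost_iff Suc_leI le_SucI)
    then show ?thesis
      using right_g[OF that De2] g_in_center[OF that] subspace_center
      by (auto intro: subspace_add subspace_scale)
  qed
  ultimately have "br a x \<in> center_N" using a by blast
  then show "br (c *s a + y) x \<in> center_N"
    using y subspace_center by (simp add: br_linear subspace_add subspace_scale)
qed

lemma center_coordinates:
  assumes "y \<in> center_N"
  obtains c s where "y = c *s e m + lincomb g {1..k} s"
proof -
  from assms obtain c where "y - c *s e m \<in> span (g ` {1..k})"
    unfolding center_N_def span_breakdown_eq by blast
  then obtain s where "y - c *s e m = lincomb g {1..k} s"
    by (rule span_family_lincomb[rotated]) simp_all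
  then have "y = c *s e m + lincomb g {1..k} s" by (simp add: algebra_simps)
  with that show ?thesis by blast
qed

lemma jordan_step_add: "jordan_step k (\<lambda>j. b j + b' j) j = jordan_step k b j + jordan_step k (b' :: nat \<Rightarrow> 'a) j"
  by (simp add: jordan_step_def)

text \<open>Central corrections of \<open>f 1, \<dots>, f k\<close> do not affect any product inside the ideal.\<close>

lemma frame_change_f:
  assumes u: "\<And>j. j \<in> {1..k} \<Longrightarrow> u j \<in> center_N"
  shows "mu3_frame scale br m k N e (\<lambda>j. if j \<le> k then f j + u j else f j) x"
    (is "mu3_frame _ _ _ _ _ _ ?f _")
proof unfold_locales
  have f': "?f ` {k + 1..2 * k} = f ` {k + 1..2 * k}" by (rule image_cong) auto
  have center_sub: "center_N \<subseteq> span (e ` {1..m} \<union> f ` {k + 1..2 * k})"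
    unfolding center_N_def g_image[symmetric] using m5 by (intro span_mono) auto
  have "f ` {k + 1..2 * k} \<subseteq> ?f ` {1..2 * k}"
    unfolding f'[symmetric] by (intro image_mono) auto
  then have center_sub': "center_N \<subseteq> span (e ` {1..m} \<union> ?f ` {1..2 * k})"
    using center_sub span_mono[of "e ` {1..m} \<union> f ` {k + 1..2 * k}" "e ` {1..m} \<union> ?f ` {1..2 * k}"] by blast
  have fN: "?f j \<in> N" if "j \<in> {1..2 * k}" for j
    using that subspace_N f_in_N[OF that] center_in_N[OF u] by (auto intro: subspace_add)
  show "span (e ` {1..m} \<union> ?f ` {1..2 * k}) = N"
  proof
    show "span (e ` {1..m} \<union> ?f ` {1..2 * k}) \<subseteq> N"
      using fN e_in_N by (intro span_minimal subspace_N) blast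
    have "f j \<in> span (e ` {1..m} \<union> ?f ` {1..2 * k})" if j: "j \<in> {1..2 * k}" for j
    proof (cases "j \<le> k")
      case True
      have "?f j \<in> span (e ` {1..m} \<union> ?f ` {1..2 * k})" using j by (intro span_base) blast
      moreover have "u j \<in> span (e ` {1..m} \<union> ?f ` {1..2 * k})" using u center_sub' j True by auto
      ultimately have "?f j - u j \<in> span (e ` {1..m} \<union> ?f ` {1..2 * k})" by (rule span_diff)
      then show ?thesis using True by simp
    next
      case False
      then have "f j \<in> ?f ` {1..2 * k}" using j by (auto simp: image_iff intro!: bexI[of _ j])
      then show ?thesis by (intro span_base) blast
    qed
    then have "span (e ` {1..m} \<union> f ` {1..2 * k}) \<subseteq> span (e ` {1..m} \<union> ?f ` {1..2 * k})"
      by (intro span_minimal subspace_span) (auto intro: span_base)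
    then show "N \<subseteq> span (e ` {1..m} \<union> ?f ` {1..2 * k})" by (simp only: span_N)
  qed
  show "br (e i) (?f j) = (if i = 2 \<and> j \<le> k then ?f (k + j) else 0)"
    if "i \<in> {1..m}" "j \<in> {1..2 * k}" for i j
    using that ef[OF that] center_right_zero[OF u] by (auto simp: br_add_right)
  show "br (?f i) (e j) = 0" if "i \<in> {1..2 * k}" "j \<in> {1..m}" for i j
    using that fe[OF that] center_left_zero[OF u e_in_N] by (auto simp: br_add_left)
  have "br (?f i) y = 0" if "i \<in> {1..2 * k}" "y \<in> N" for i y
    using that f_left_zero[OF that] center_left_zero[OF u that(2)] by (auto simp: br_add_left)
  then show "br (?f i) (?f j) = 0" if "i \<in> {1..2 * k}" "j \<in> {1..2 * k}" for i j
    using that fN by blast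
  show "br (?f j) x - jordan_step k ?f j \<in> span (e ` {1..m} \<union> ?f ` {k + 1..2 * k})"
    if j: "j \<in> {1..k}" for j
  proof -
    have "jordan_step k ?f j = jordan_step k (\<lambda>j. f j + u j) j"
      using j by (auto simp: jordan_step_def)
    then have "br (?f j) x - jordan_step k ?f j
        = (br (f j) x - jordan_step k f j) + (br (u j) x - jordan_step k u j)"
      using j by (simp add: jordan_step_add br_add_left)
    moreover have "br (u j) x - jordan_step k u j \<in> center_N"
      using subspace_center center_right_x u j
      by (auto simp: jordan_step_def intro!: subspace_diff subspace_add)
    ultimately show ?thesis
      using fx[OF j] center_sub unfolding f' by (metis span_add subsetD)
  qed
qed (fact m5 k1 ideal span_x dim ee)+

end

text \<open>The left multiplication by \<open>x\<close> is minus the Jordan block exactly, not only modulo the center.\<close>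

locale mu3_normal_frame = mu3_frame +
  assumes pure: "pure_e_action m k e f x"
    and left_f_exact: "\<And>j. j \<in> {1..k} \<Longrightarrow> br x (f j) = - jordan_step k f j"

text \<open>Left multiplication by \<open>x\<close> kills central elements, so replacing \<open>f j\<close> by \<open>f j + u j\<close> with \<open>u j\<close>
central changes the defect of \<open>[x, f j]\<close> by the Jordan block applied to \<open>u\<close>. Rewriting \<open>[x, e 1]\<close> in
the new \<open>f j\<close> brings back a multiple of \<open>e m\<close>, which a multiple of \<open>e (m - 1)\<close> added to \<open>x\<close> removes;
since \<open>m - 1 > 2\<close>, this does not disturb \<open>[x, f j]\<close>.\<close>

lemma (in mu3_frame) normal_frame_exists_pure:
  assumes "pure_e_action m k e f x"
  obtains f' y where "mu3_normal_frame scale br m k N e f' y"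
proof -
  have "\<forall>j\<in>{1..k}. \<exists>w\<in>center_N. br x (f j) = - jordan_step k f j + w"
  proof
    fix j assume "j \<in> {1..k}"
    then obtain r s where "br x (f j) = - jordan_step k f j + r *s e m + lincomb g {1..k} s"
      by (rule left_f)
    moreover have "r *s e m + lincomb g {1..k} s \<in> center_N"
      using subspace_center em_in_center g_in_center by (intro subspace_add subspace_scale lincomb_mem) auto
    ultimately show "\<exists>w\<in>center_N. br x (f j) = - jordan_step k f j + w"
      by (metis add.assoc)
  qed
  then obtain w where w: "\<And>j. j \<in> {1..k} \<Longrightarrow> w j \<in> center_N"
    "\<And>j. j \<in> {1..k} \<Longrightarrow> br x (f j) = - jordan_step k f j + w j" by metis
  obtain u where u: "\<And>j. j \<in> {1..k} \<Longrightarrow> jordan_step k u j = - w j"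
    and uW: "\<And>j. j \<in> {1..k} \<Longrightarrow> u j \<in> center_N"
    by (rule jordan_step_surj[of center_N k "\<lambda>j. - w j"])
      (use subspace_center w(1) in \<open>auto intro: subspace_0 subspace_diff subspace_neg\<close>)
  define f' where "f' = (\<lambda>j. if j \<le> k then f j + u j else f j)"
  interpret new: mu3_frame scale br m k N e f' x
    unfolding f'_def using uW by (rule frame_change_f)
  have lf: "lincomb f' {1..k} c = lincomb f {1..k} c + lincomb u {1..k} c" for c
    unfolding lincomb_vec_add[symmetric] by (rule lincomb_cong) (auto simp: f'_def)
  have lg: "lincomb new.g {1..k} c = lincomb g {1..k} c" for c
    by (rule lincomb_cong) (auto simp: f'_def)
  from assms obtain a \<beta> \<theta> c \<gamma> \<delta> where Le1: "br x (e 1) = a *s e 1 + lincomb f {1..k} \<beta> + lincomb g {1..k} \<theta>"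
    and De2: "br (e 2) x = c *s e 2 + lincomb e {4..m} \<gamma> + lincomb g {1..k} \<delta>"
    unfolding pure_e_action_def by blast
  have "lincomb u {1..k} \<beta> \<in> center_N" using subspace_center uW by (rule lincomb_mem)
  then obtain d s where d: "lincomb u {1..k} \<beta> = d *s e m + lincomb g {1..k} s"
    by (rule center_coordinates)
  define y where "y = d *s e (m - 1)"
  have em1: "m - 1 \<in> {1..m}" using m5 by auto
  have yN: "y \<in> N" unfolding y_def using em1 subspace_N by (intro subspace_scale e_in_N)
  have "br (e (m - 1)) (e 1) = e m" using m5 by (auto simp: ee)
  then have "br (x + y) (e 1) = a *s e 1 + lincomb f' {1..k} \<beta> + lincomb new.g {1..k} (\<lambda>i. \<theta> i - s i)"
    by (simp add: br_add_left br_scale_left y_def Le1 lf lg d lincomb_diff[symmetric])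
  moreover have "br (e 2) y = 0" unfolding y_def br_scale_right using m5 by (auto simp: ee)
  then have "br (e 2) (x + y) = c *s e 2 + lincomb e {4..m} \<gamma> + lincomb new.g {1..k} \<delta>"
    by (simp add: br_add_right De2 lg)
  ultimately have "pure_e_action m k e f' (x + y)"
    unfolding pure_e_action_def by blast
  moreover have "br (x + y) (f' j) = - jordan_step k f' j" if j: "j \<in> {1..k}" for j
  proof -
    have "jordan_step k f' j = jordan_step k (\<lambda>j. f j + u j) j"
      using j by (auto simp: jordan_step_def f'_def)
    then have "br x (f' j) = - jordan_step k f' j"
      using j by (simp add: jordan_step_add u w(2) f'_def br_add_right center_right_zero[OF uW])
    moreover have "br y (f' j) = 0" unfolding y_def br_scale_left
      using new.ef[OF em1, of j] j m5 by auto
    ultimately show ?thesis by (simp add: br_add_left)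
  qed
  ultimately have "mu3_normal_frame scale br m k N e f' (x + y)"
    using new.frame_change_x[OF yN]
    by (simp add: mu3_normal_frame_def mu3_normal_frame_axioms_def)
  with that show ?thesis by blast
qed

lemma (in mu3_frame) normal_frame_exists:
  obtains f' y where "mu3_normal_frame scale br m k N e f' y"
proof -
  obtain y where "y \<in> N" and p: "pure_e_action m k e f (x + y)" by (rule pure_e_action_exists)
  then interpret new: mu3_frame scale br m k N e f "x + y" by (intro frame_change_x)
  from new.normal_frame_exists_pure[OF p] that show ?thesis by blast
qed

section \<open>Relations in a normal frame\<close>

lemma jordan_step_inj:
  fixes E :: "nat \<Rightarrow> 'b::ab_group_add"
  assumes "\<And>j. j \<in> {1..k} \<Longrightarrow> jordan_step k E j = 0" and "j \<in> {1..k}"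
  shows "E j = 0"
proof -
  have "j \<le> k" "1 \<le> j" using assms(2) by auto
  then show ?thesis
  proof (induction rule: inc_induct)
    case base
    then show ?case using assms(1)[of k] by (simp add: jordan_step_def)
  next
    case (step i)
    then show ?case using assms(1)[of i] by (simp add: jordan_step_def)
  qed
qed

lemma jordan_coeff_inj:
  assumes "\<And>j. j \<in> {1..k} \<Longrightarrow> jordan_coeff d j = 0" and "j \<in> {1..k}"
  shows "d j = 0"
proof -
  have "1 \<le> j" "j \<le> k" using assms(2) by auto
  then show ?thesis
  proof (induction rule: dec_induct)
    case base
    then show ?case using assms(1)[of 1] by (simp add: jordan_coeff_def)
  next
    case (step i)
    then show ?case using assms(1)[of "Suc i"] by (simp add: jordan_coeff_def)
  qed
qed

context mu3_frame
begin

lemma right_g_span: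
  assumes "br (e 2) x = lincomb e {2..m} \<gamma> + lincomb g {1..k} \<delta>"
  shows "br (lincomb g {1..k} d) x = lincomb g {1..k} (\<lambda>i. \<gamma> 2 * d i + jordan_coeff d i)"
proof -
  have "br (lincomb g {1..k} d) x = lincomb (\<lambda>j. \<gamma> 2 *s g j + jordan_step k g j) {1..k} d"
    unfolding br_lincomb_left by (rule lincomb_cong) (auto simp: right_g[OF _ assms])
  also have "\<dots> = \<gamma> 2 *s lincomb g {1..k} d + lincomb g {1..k} (jordan_coeff d)"
    by (simp only: lincomb_vec_add lincomb_vec_scale lincomb_jordan_step)
  finally show ?thesis by (simp only: lincomb_scale lincomb_add)
qed

end

context mu3_normal_frame
begin

lemma left_f_span: "br x (lincomb f {1..k} d) = - lincomb f {1..k} (jordan_coeff d)"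
proof -
  have "br x (lincomb f {1..k} d) = lincomb (\<lambda>j. - jordan_step k f j) {1..k} d"
    unfolding br_lincomb_right by (rule lincomb_cong) (auto simp: left_f_exact)
  then show ?thesis by (simp only: lincomb_vec_minus lincomb_jordan_step)
qed

lemma left_g_span: "br w (lincomb g {1..k} d) = 0"
  unfolding br_lincomb_right by (rule lincomb_vec_zero) (rule x_g_zero)

lemma normal_e2:
  obtains \<gamma> \<delta> where "\<gamma> 3 = 0"
    "br (e 2) x = lincomb e {2..m} \<gamma> + lincomb g {1..k} \<delta>"
proof -
  from pure obtain c \<gamma> \<delta> where
    De2: "br (e 2) x = c *s e 2 + lincomb e {4..m} \<gamma> + lincomb g {1..k} \<delta>"
    unfolding pure_e_action_def by blast
  define \<gamma>' where "\<gamma>' = \<gamma>(2 := c, 3 := 0)"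
  have "lincomb e {4..m} \<gamma>' = lincomb e {4..m} \<gamma>" by (rule lincomb_cong) (auto simp: \<gamma>'_def)
  then have "br (e 2) x = lincomb e {2..m} \<gamma>' + lincomb g {1..k} \<delta>"
    unfolding De2 lincomb_e_split3 by (simp add: \<gamma>'_def)
  moreover have "\<gamma>' 3 = 0" by (simp add: \<gamma>'_def)
  ultimately show ?thesis using that by blast
qed

text \<open>Compared with \<open>left_e1\<close>, the \<open>e\<close>-part is gone, by uniqueness of coordinates.\<close>

lemma normal_left_e1:
  assumes De1: "br (e 1) x = a *s e 1 + am *s e m + lincomb f {1..k} \<beta> + lincomb g {1..k} \<beta>'"
  obtains \<theta> where "br x (e 1) = - (a *s e 1) - lincomb f {1..k} \<beta> + lincomb g {1..k} \<theta>"
proof -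
  obtain p \<theta> where Le1:
    "br x (e 1) = - (a *s e 1) - lincomb f {1..k} \<beta> + lincomb e {3..m} p + lincomb g {1..k} \<theta>"
    using De1 by (rule left_e1)
  from pure obtain a0 \<beta>0 \<theta>0 where
    Le1': "br x (e 1) = a0 *s e 1 + lincomb f {1..k} \<beta>0 + lincomb g {1..k} \<theta>0"
    unfolding pure_e_action_def by blast
  have head: "lincomb e {1..m} (\<lambda>i. if i = 1 then - a - a0 else if i = 2 then 0 else p i)
      = (- a - a0) *s e 1 + lincomb e {3..m} p"
  proof -
    have "lincomb e {2..m} (\<lambda>i. if i = 1 then - a - a0 else if i = 2 then 0 else p i)
        = lincomb e {2..m} (\<lambda>i. if i \<in> {3..m} then p i else 0)"
      by (rule lincomb_cong) auto
    also have "\<dots> = lincomb e {3..m} p" by (rule lincomb_extend[symmetric]) auto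
    finally show ?thesis unfolding lincomb_e_split by simp
  qed
  have eq0: "(- (a *s e 1) - lincomb f {1..k} \<beta> + lincomb e {3..m} p + lincomb g {1..k} \<theta>)
      - (a0 *s e 1 + lincomb f {1..k} \<beta>0 + lincomb g {1..k} \<theta>0) = 0"
    using Le1 Le1' by simp
  have "comb (\<lambda>i. if i = 1 then - a - a0 else if i = 2 then 0 else p i)
      (\<lambda>i. - \<beta> i - \<beta>0 i) (\<lambda>i. \<theta> i - \<theta>0 i) = 0"
    unfolding head lincomb_diff[symmetric] lincomb_minus[symmetric]
    using eq0 by (simp add: algebra_simps)
  from comb_eq_0[OF this] have z: "\<forall>i\<in>{1..m}. (if i = 1 then - a - a0 else if i = 2 then 0 else p i) = 0"
    by blast
  have "p i = 0" if "i \<in> {3..m}" for i using z[rule_format, of i] that by auto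
  then have "lincomb e {3..m} p = 0" by (rule lincomb_coeff_zero)
  with Le1 that show ?thesis by simp
qed

text \<open>The coordinates of the Leibniz identity \<open>[x, [e 1, x]] = [[x, e 1], x] - [[x, x], e 1]\<close>. The last
term is the shift of the \<open>e\<close>-part of \<open>[x, x]\<close>. The parameters \<open>\<phi>\<close> and \<open>s\<close> measure the central defect of
\<open>[f j, x]\<close>; they are kept because the identity is first used, through \<open>t 2 = 0\<close>, to show that this
defect vanishes.\<close>

lemma e1_x_identity:
  assumes De1: "br (e 1) x = a *s e 1 + am *s e m + lincomb f {1..k} \<beta> + lincomb g {1..k} \<beta>'"
    and De2: "br (e 2) x = lincomb e {2..m} \<gamma> + lincomb g {1..k} \<delta>"
    and Le1: "br x (e 1) = - (a *s e 1) - lincomb f {1..k} \<beta> + lincomb g {1..k} \<theta>"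
    and xx: "br x x = lincomb e {2..m} t + lincomb g {1..k} \<tau>"
    and Df: "br (lincomb f {1..k} \<beta>) x = lincomb f {1..k} (jordan_coeff \<beta>) + (\<phi> *s e m + lincomb g {1..k} s)"
  shows "\<And>i. i \<in> {2..m - 2} \<Longrightarrow> t i = 0" and "t (m - 1) = - (a * am) - \<phi>"
    and "\<And>j. j \<in> {1..k} \<Longrightarrow> jordan_coeff \<theta> j + (\<gamma> 2 - a) * \<theta> j = a * \<beta>' j + s j"
proof -
  define F G where "F = lincomb f {1..k}" and "G = lincomb g {1..k}"
  have "br x (e m) = 0" using m5 by (intro x_e_zero) auto
  then have "br x (br (e 1) x) = a *s br x (e 1) - F (jordan_coeff \<beta>)"
    unfolding De1 using left_f_span left_g_span by (simp add: br_linear F_def)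
  moreover have "br (br x (e 1)) x
      = - (a *s br (e 1) x) - (F (jordan_coeff \<beta>) + (\<phi> *s e m + G s)) + G (\<lambda>i. \<gamma> 2 * \<theta> i + jordan_coeff \<theta> i)"
    unfolding Le1 br_add_left br_diff_left br_minus_left br_scale_left Df right_g_span[OF De2] F_def G_def ..
  moreover have "br (br x x) (e 1) = lincomb e {3..m} (\<lambda>i. t (i - 1))"
    unfolding xx using tail_br_e1[of 2] by simp
  moreover have "br x (br (e 1) x) = br (br x (e 1)) x - br (br x x) (e 1)" by (rule right_leibniz)
  ultimately have "a *s (- (a *s e 1) - F \<beta> + G \<theta>) - F (jordan_coeff \<beta>)
      = - (a *s (a *s e 1 + am *s e m + F \<beta> + G \<beta>'))
        - (F (jordan_coeff \<beta>) + (\<phi> *s e m + G s)) + G (\<lambda>i. \<gamma> 2 * \<theta> i + jordan_coeff \<theta> i)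
        - lincomb e {3..m} (\<lambda>i. t (i - 1))"
    unfolding Le1 De1 F_def G_def by simp
  then have "lincomb e {3..m} (\<lambda>i. t (i - 1)) + ((a * am) *s e m + \<phi> *s e m)
      + (a *s G \<theta> + a *s G \<beta>' + G s - G (\<lambda>i. \<gamma> 2 * \<theta> i + jordan_coeff \<theta> i)) = 0"
    by (simp add: algebra_simps)
  moreover have "(a * am) *s e m + \<phi> *s e m = lincomb e {3..m} (\<lambda>i. if i = m then a * am + \<phi> else 0)"
    using m5 by (simp add: lincomb_delta scale_left_distrib)
  ultimately have "lincomb e {3..m} (\<lambda>i. t (i - 1) + (if i = m then a * am + \<phi> else 0)) + lincomb f {} (\<lambda>_. 0)
      + G (\<lambda>i. a * \<theta> i + a * \<beta>' i + s i - (\<gamma> 2 * \<theta> i + jordan_coeff \<theta> i)) = 0"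
    by (simp add: lincomb_add[symmetric] lincomb_diff[symmetric] lincomb_scale[symmetric] G_def lincomb_def[of f])
  note z = comb_sub_eq_0[OF this[unfolded G_def]]
  have ze: "t (i - 1) + (if i = m then a * am + \<phi> else 0) = 0" if "i \<in> {3..m}" for i
    by (rule z(1)) (use that in auto)
  show "t i = 0" if "i \<in> {2..m - 2}" for i
  proof -
    have "Suc i \<in> {3..m}" "Suc i \<noteq> m" using that by auto
    then show ?thesis using ze[of "Suc i"] by simp
  qed
  have "t (m - 1) + (a * am + \<phi>) = 0" using ze[of m] m5 by simp
  then have "t (m - 1) = - (a * am + \<phi>)" by (simp only: eq_neg_iff_add_eq_0)
  then show "t (m - 1) = - (a * am) - \<phi>" by simp
  show "jordan_coeff \<theta> j + (\<gamma> 2 - a) * \<theta> j = a * \<beta>' j + s j" if "j \<in> {1..k}" for j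
  proof -
    have "a * \<theta> j + a * \<beta>' j + s j - (\<gamma> 2 * \<theta> j + jordan_coeff \<theta> j) = 0"
      by (rule z(3)) (use that in auto)
    then show ?thesis by (simp add: algebra_simps)
  qed
qed

lemma xx_coordinates:
  obtains t \<tau> where "br x x = lincomb e {2..m} t + lincomb g {1..k} \<tau>"
  using annihilator_coordinates[OF xx_in_N br_square_right] by blast

text \<open>Since \<open>[[x, x], f j] = t 2 f (k + j) = 0\<close>, the Leibniz identity for \<open>[x, [f j, x]]\<close> shows that the
Jordan block annihilates the defect \<open>E\<close> of \<open>[f j, x]\<close>, and the block is injective.\<close>

lemma right_f_exact:
  assumes "j \<in> {1..k}"
  shows "br (f j) x = jordan_step k f j"
proof -
  obtain a am \<beta> \<beta>' where De1:
    "br (e 1) x = a *s e 1 + am *s e m + lincomb f {1..k} \<beta> + lincomb g {1..k} \<beta>'"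
    by (rule right_e1)
  obtain \<gamma> \<delta> where De2: "br (e 2) x = lincomb e {2..m} \<gamma> + lincomb g {1..k} \<delta>"
    by (rule right_e2)
  obtain \<theta> where Le1: "br x (e 1) = - (a *s e 1) - lincomb f {1..k} \<beta> + lincomb g {1..k} \<theta>"
    using De1 by (rule normal_left_e1)
  obtain t \<tau> where xx: "br x x = lincomb e {2..m} t + lincomb g {1..k} \<tau>"
    by (rule xx_coordinates)
  define E where "E j = br (f j) x - jordan_step k f j" for j
  have E: "E j \<in> center_N" if j: "j \<in> {1..k}" for j
  proof -
    obtain \<phi> s where "br (f j) x = jordan_step k f j + \<phi> *s e m + lincomb g {1..k} s"
      using j by (rule right_f)
    then have "E j = \<phi> *s e m + lincomb g {1..k} s" by (simp add: E_def)
    then show ?thesis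
      using subspace_center em_in_center g_in_center by (auto intro!: subspace_add subspace_scale lincomb_mem)
  qed
  have "lincomb E {1..k} \<beta> \<in> center_N" using subspace_center E by (rule lincomb_mem)
  then obtain \<phi> s where "lincomb E {1..k} \<beta> = \<phi> *s e m + lincomb g {1..k} s" by (rule center_coordinates)
  moreover have "br (lincomb f {1..k} \<beta>) x = lincomb (jordan_step k f) {1..k} \<beta> + lincomb E {1..k} \<beta>"
    unfolding br_lincomb_left lincomb_vec_add[symmetric] by (simp add: E_def)
  ultimately have Df: "br (lincomb f {1..k} \<beta>) x
      = lincomb f {1..k} (jordan_coeff \<beta>) + (\<phi> *s e m + lincomb g {1..k} s)"
    by (simp add: lincomb_jordan_step)
  have t2: "t 2 = 0" using e1_x_identity(1)[OF De1 De2 Le1 xx Df, of 2] m5 by simp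
  have "jordan_step k E j = 0" if j: "j \<in> {1..k}" for j
  proof -
    have step: "br x (jordan_step k f j) = - jordan_step k (jordan_step k f) j"
      using j by (auto simp: jordan_step_def[of k f] jordan_step_def[of k "jordan_step k f"]
          br_linear left_f_exact)
    have "br x (br (f j) x) = br x (jordan_step k f j) + br x (E j)"
      by (simp add: E_def br_linear)
    then have "br x (br (f j) x) = - jordan_step k (jordan_step k f) j"
      using center_right_zero[OF E[OF j]] step by simp
    moreover have "br (br x (f j)) x = - jordan_step k (\<lambda>j. br (f j) x) j"
      using j by (simp add: left_f_exact jordan_step_def br_linear)
    moreover have "br (br x x) (f j) = 0" using tail_br_f[OF j, of t \<tau>] t2 by (simp add: xx)
    ultimately have "jordan_step k (jordan_step k f) j = jordan_step k (\<lambda>j. br (f j) x) j"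
      using right_leibniz[of x "f j" x] by simp
    moreover have "jordan_step k E j
        = jordan_step k (\<lambda>j. br (f j) x) j - jordan_step k (jordan_step k f) j"
      by (simp add: jordan_step_def[of k E] jordan_step_def[of k "\<lambda>j. br (f j) x"]
          jordan_step_def[of k "jordan_step k f"] E_def)
    ultimately show ?thesis by simp
  qed
  from jordan_step_inj[of k E, OF this assms] show ?thesis by (simp add: E_def)
qed

lemma right_f_span: "br (lincomb f {1..k} d) x = lincomb f {1..k} (jordan_coeff d)"
proof -
  have "br (lincomb f {1..k} d) x = lincomb (jordan_step k f) {1..k} d"
    unfolding br_lincomb_left by (rule lincomb_cong) (auto simp: right_f_exact)
  then show ?thesis by (simp only: lincomb_jordan_step)
qed

lemma normal_relations:
  assumes De1: "br (e 1) x = a *s e 1 + am *s e m + lincomb f {1..k} \<beta> + lincomb g {1..k} \<beta>'"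
    and De2: "br (e 2) x = lincomb e {2..m} \<gamma> + lincomb g {1..k} \<delta>"
    and Le1: "br x (e 1) = - (a *s e 1) - lincomb f {1..k} \<beta> + lincomb g {1..k} \<theta>"
    and xx: "br x x = lincomb e {2..m} t + lincomb g {1..k} \<tau>"
  shows "lincomb e {2..m} t = (- (a * am)) *s e (m - 1) + t m *s e m"
    and "\<And>j. j \<in> {1..k} \<Longrightarrow> jordan_coeff \<theta> j + (\<gamma> 2 - a) * \<theta> j = a * \<beta>' j"
proof -
  have "br (lincomb f {1..k} \<beta>) x
      = lincomb f {1..k} (jordan_coeff \<beta>) + (0 *s e m + lincomb g {1..k} (\<lambda>_. 0))"
    by (simp add: right_f_span) (simp add: lincomb_def)
  note id = e1_x_identity[OF De1 De2 Le1 xx this]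
  have "lincomb e {2..m} t = lincomb e {2..m - 2} t + t (m - 1) *s e (m - 1) + t m *s e m"
    using lincomb_split_last[of 2 m e t] lincomb_split_last[of 2 "m - 1" e t] m5
    by (simp add: numeral_2_eq_2)
  moreover have "lincomb e {2..m - 2} t = 0" by (rule lincomb_coeff_zero) (rule id(1))
  ultimately show "lincomb e {2..m} t = (- (a * am)) *s e (m - 1) + t m *s e m"
    using id(2) by simp
  show "\<And>j. j \<in> {1..k} \<Longrightarrow> jordan_coeff \<theta> j + (\<gamma> 2 - a) * \<theta> j = a * \<beta>' j"
    using id(3) by simp
qed

text \<open>The Leibniz identity for \<open>[x, [e 2, x]]\<close> says that \<open>[x, e 2]\<close> is an eigenvector of right
multiplication by \<open>x\<close> for \<open>\<gamma> 2\<close>, which acts on \<open>e m\<close> by \<open>(m - 2) a + \<gamma> 2\<close> and on the \<open>f (k + j)\<close> by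
\<open>\<gamma> 2 + J\<close>. So the coordinates at the \<open>f (k + j)\<close> vanish, \<open>J\<close> being injective, and \<open>(m - 2) a q = 0\<close>.
The identity for \<open>[x, [x, e 2]]\<close> says that the eigenvalue kills \<open>[x, e 2]\<close>.\<close>

lemma normal_left_e2:
  assumes De1: "br (e 1) x = a *s e 1 + am *s e m + lincomb f {1..k} \<beta> + lincomb g {1..k} \<beta>'"
    and De2: "br (e 2) x = lincomb e {2..m} \<gamma> + lincomb g {1..k} \<delta>"
  obtains q where "br x (e 2) = q *s e m" "\<gamma> 2 * q = 0" "of_nat (m - 2) * a * q = 0"
proof -
  obtain q \<eta> where Le2: "br x (e 2) = q *s e m + lincomb g {1..k} \<eta>" by (rule left_e2)
  have Dm: "br (e m) x = (of_nat (m - 2) * a) *s e m + \<gamma> 2 *s e m"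
    using right_e[OF De1 De2, of m] m5 by (simp add: lincomb_single del: add_2_eq_Suc' add_2_eq_Suc)
  have xe: "br x (e i) = 0" if "i \<in> {3..m}" for i using that by (rule x_e_zero)
  have "br x (lincomb e {4..m} \<gamma>) = 0"
    unfolding br_lincomb_right by (rule lincomb_vec_zero) (auto intro: xe)
  moreover have "br x (e 3) = 0" using m5 by (intro xe) auto
  ultimately have "br x (br (e 2) x) = \<gamma> 2 *s br x (e 2)"
    unfolding De2 lincomb_e_split3 using left_g_span by (simp add: br_linear)
  moreover have "br (br x x) (e 2) = 0" using m5 xx_in_N by (intro e_right_zero) auto
  ultimately have eq: "\<gamma> 2 *s br x (e 2) = br (br x (e 2)) x"
    using right_leibniz[of x "e 2" x] by simp
  have D: "br (br x (e 2)) x = q *s ((of_nat (m - 2) * a) *s e m + \<gamma> 2 *s e m)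
      + lincomb g {1..k} (\<lambda>i. \<gamma> 2 * \<eta> i + jordan_coeff \<eta> i)"
    unfolding Le2 br_add_left br_scale_left Dm right_g_span[OF De2] ..
  have D': "br (br x (e 2)) x = lincomb e {m} (\<lambda>_. q * (of_nat (m - 2) * a) + q * \<gamma> 2) + lincomb f {} (\<lambda>_. 0)
      + lincomb g {1..k} (\<lambda>i. \<gamma> 2 * \<eta> i + jordan_coeff \<eta> i)"
    unfolding D lincomb_single by (simp add: scale_right_distrib scale_left_distrib lincomb_def[of f])
  have "\<gamma> 2 *s br x (e 2) = lincomb e {m} (\<lambda>_. \<gamma> 2 * q) + lincomb f {} (\<lambda>_. 0)
      + lincomb g {1..k} (\<lambda>i. \<gamma> 2 * \<eta> i)"
    unfolding Le2 lincomb_single by (simp add: scale_right_distrib lincomb_scale lincomb_def[of f])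
  with eq D' have "lincomb e {m} (\<lambda>_. q * (of_nat (m - 2) * a)) + lincomb f {} (\<lambda>_. 0)
      + lincomb g {1..k} (jordan_coeff \<eta>) = 0"
    unfolding lincomb_single
    by (simp add: lincomb_add[symmetric] scale_left_distrib mult.commute lincomb_def[of f])
  from comb_sub_eq_0[OF this] m5
  have 1: "q * (of_nat (m - 2) * a) = 0" and "\<And>j. j \<in> {1..k} \<Longrightarrow> jordan_coeff \<eta> j = 0" by auto
  then have "\<eta> j = 0" if "j \<in> {1..k}" for j using jordan_coeff_inj[of k \<eta>] that by blast
  then have "lincomb g {1..k} \<eta> = 0" by (rule lincomb_coeff_zero)
  then have Le2': "br x (e 2) = q *s e m" using Le2 by simp
  have "br x (e m) = 0" using m5 by (intro xe) auto
  then have "br (br x (e 2)) x = 0"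
    using right_leibniz[of x x "e 2"] \<open>br (br x x) (e 2) = 0\<close> Le2' by (simp add: br_linear)
  then have "lincomb e {m} (\<lambda>_. \<gamma> 2 * q) + lincomb f {} (\<lambda>_. 0) + lincomb g {} (\<lambda>_. 0) = 0"
    using eq Le2' by (simp add: lincomb_def)
  from comb_sub_eq_0(1)[OF this, of m] m5 have "\<gamma> 2 * q = 0" by auto
  moreover have "of_nat (m - 2) * a * q = 0" using 1 by (simp add: mult.commute mult.left_commute)
  ultimately show ?thesis using Le2' that by blast
qed

end

section \<open>Removing the remaining coefficients\<close>

context mu3_frame
begin

lemma g_span_in_center: "lincomb g {1..k} d \<in> center_N"
  using subspace_center g_in_center by (rule lincomb_mem)

text \<open>The correction of \<open>e 3\<close> is forced by \<open>e 3 = [e 2, e 1]\<close>. The corrections are killed by right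
multiplication by elements of the ideal, and only \<open>[e 2, f j]\<close> sees the change of \<open>e 1\<close>.\<close>

lemma frame_change_e:
  fixes \<rho> \<rho>' \<xi> :: "nat \<Rightarrow> complex"
  defines "e' \<equiv> e(1 := e 1 + lincomb f {1..k} \<rho> + lincomb g {1..k} \<rho>',
      2 := e 2 + lincomb g {1..k} \<xi>, 3 := e 3 + lincomb g {1..k} \<rho>)"
  shows "mu3_frame scale br m k N e' f x"
proof unfold_locales
  have in_center: "lincomb g {1..k} d \<in> center_N" for d by (rule g_span_in_center)
  define v where "v i = (if i = 1 then lincomb f {1..k} \<rho> + lincomb g {1..k} \<rho>'
      else if i = 2 then lincomb g {1..k} \<xi> else if i = 3 then lincomb g {1..k} \<rho> else 0)" for i :: nat
  have e': "e' i = e i + v i" for i by (simp add: e'_def v_def)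
  have v_span: "v i \<in> span (f ` {1..2 * k})" for i
  proof -
    have f: "f j \<in> span (f ` {1..2 * k})" if "j \<in> {1..2 * k}" for j
      using that by (intro span_base) blast
    have "lincomb f {1..k} d \<in> span (f ` {1..2 * k})" "lincomb g {1..k} d \<in> span (f ` {1..2 * k})" for d
      by (rule lincomb_mem[OF subspace_span], rule f, simp)+
    then show ?thesis unfolding v_def by (simp add: span_add span_zero)
  qed
  have fN: "span (f ` {1..2 * k}) \<subseteq> N" using f_in_N by (intro span_minimal subspace_N) auto
  have vN: "v i \<in> N" for i using v_span fN by blast
  have e'N: "e' i \<in> N" if "i \<in> {1..m}" for i
    unfolding e' using e_in_N[OF that] vN subspace_N by (intro subspace_add) auto
  have v_left: "br (v i) y = 0" if "y \<in> N" for i y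
  proof -
    have "v i \<in> span (f ` {1..2 * k})" by (rule v_span)
    then show ?thesis
      by (induction rule: span_induct_alt) (use that f_left_zero in \<open>auto simp: br_linear\<close>)
  qed
  show "span (e' ` {1..m} \<union> f ` {1..2 * k}) = N"
  proof
    show "span (e' ` {1..m} \<union> f ` {1..2 * k}) \<subseteq> N"
      using e'N f_in_N by (intro span_minimal subspace_N) blast
    have "span (f ` {1..2 * k}) \<subseteq> span (e' ` {1..m} \<union> f ` {1..2 * k})" by (intro span_mono) auto
    then have vs: "v i \<in> span (e' ` {1..m} \<union> f ` {1..2 * k})" for i using v_span by blast
    have "e i \<in> span (e' ` {1..m} \<union> f ` {1..2 * k})" if "i \<in> {1..m}" for i
    proof -
      have "e' i \<in> span (e' ` {1..m} \<union> f ` {1..2 * k})" using that by (intro span_base) blast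
      from span_diff[OF this vs[of i]] show ?thesis by (simp add: e')
    qed
    then have "span (e ` {1..m} \<union> f ` {1..2 * k}) \<subseteq> span (e' ` {1..m} \<union> f ` {1..2 * k})"
      by (intro span_minimal subspace_span) (auto intro: span_base)
    then show "N \<subseteq> span (e' ` {1..m} \<union> f ` {1..2 * k})" by (simp only: span_N)
  qed
  show "br (e' i) (e' j) = (if 2 \<le> i \<and> i \<le> m - 1 \<and> j = 1 then e' (i + 1) else 0)"
    if i: "i \<in> {1..m}" and j: "j \<in> {1..m}" for i j
  proof -
    have "br (e' i) (e' j) = br (e i) (e j) + br (e i) (v j)"
      using v_left[OF e'N[OF j]] by (simp add: e' br_linear)
    moreover have "br (e i) (v j) = (if i = 2 \<and> j = 1 then lincomb g {1..k} \<rho> else 0)"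
    proof (cases "j = 1")
      case True
      have "br (e i) (v 1) = br (e i) (lincomb f {1..k} \<rho>)"
        by (simp add: v_def br_add_right center_right_zero[OF in_center])
      moreover have "br (e i) (lincomb f {1..k} \<rho>) = 0" if "i \<noteq> 2"
        unfolding br_lincomb_right by (rule lincomb_vec_zero) (use that i in \<open>auto simp: ef\<close>)
      moreover have "br (e 2) (lincomb f {1..k} \<rho>) = lincomb g {1..k} \<rho>"
        unfolding br_lincomb_right using m5 by (intro lincomb_cong) (auto simp: ef)
      ultimately show ?thesis using True by auto
    next
      case False
      then show ?thesis by (simp add: v_def center_right_zero[OF in_center] br_zero_right)
    qed
    ultimately show ?thesis using ee[OF i j] m5 by (auto simp: e' v_def)
  qed
  show "br (e' i) (f j) = (if i = 2 \<and> j \<le> k then f (k + j) else 0)"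
    if "i \<in> {1..m}" "j \<in> {1..2 * k}" for i j
    using ef[OF that] v_left[OF f_in_N[OF that(2)]] by (simp add: e' br_add_left)
  show "br (f i) (e' j) = 0" if "i \<in> {1..2 * k}" "j \<in> {1..m}" for i j
    using f_left_zero[OF that(1) e'N[OF that(2)]] .
  show "br (f j) x - jordan_step k f j \<in> span (e' ` {1..m} \<union> f ` {k + 1..2 * k})"
    if j: "j \<in> {1..k}" for j
  proof -
    obtain \<phi> s where "br (f j) x = jordan_step k f j + \<phi> *s e m + lincomb g {1..k} s"
      using j by (rule right_f)
    then have "br (f j) x - jordan_step k f j = \<phi> *s e m + lincomb g {1..k} s" by simp
    also have "\<dots> \<in> center_N" using subspace_center em_in_center in_center by (intro subspace_add subspace_scale)
    finally have "br (f j) x - jordan_step k f j \<in> center_N" .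
    moreover have "e' m = e m" using m5 by (simp add: e' v_def)
    then have "insert (e m) (g ` {1..k}) \<subseteq> e' ` {1..m} \<union> f ` {k + 1..2 * k}"
      unfolding g_image using m5 by (auto simp: image_iff intro!: bexI[of _ m])
    then have "center_N \<subseteq> span (e' ` {1..m} \<union> f ` {k + 1..2 * k})" unfolding center_N_def by (rule span_mono)
    ultimately show ?thesis by blast
  qed
qed (fact m5 k1 ideal span_x dim ff)+

end

context mu3_normal_frame
begin

text \<open>The coordinates of \<open>[e 1, x]\<close> at \<open>f 1, \<dots>, f k\<close> move by the image of \<open>J - a\<close>, and those at the
\<open>f (k + j)\<close> by the image of \<open>J + \<gamma> 2 - a\<close>; the coordinates of \<open>[e 2, x]\<close> at the \<open>f (k + j)\<close> move by the
image of \<open>J\<close>, the eigenvalue \<open>\<gamma> 2\<close> of \<open>e 2\<close> cancelling.\<close>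

lemma reduced_e_exists:
  obtains e' a am b1 b2 \<gamma> where "mu3_normal_frame scale br m k N e' f x"
    and "br (e' 1) x = a *s e' 1 + am *s e' m + b1 *s f 1 + b2 *s f (k + 1)"
    and "br (e' 2) x = lincomb e' {2..m} \<gamma>" and "\<gamma> 3 = 0"
proof -
  obtain a am \<beta> \<beta>' where De1:
    "br (e 1) x = a *s e 1 + am *s e m + lincomb f {1..k} \<beta> + lincomb g {1..k} \<beta>'"
    by (rule right_e1)
  obtain \<gamma> \<delta> where g3: "\<gamma> 3 = 0" and De2: "br (e 2) x = lincomb e {2..m} \<gamma> + lincomb g {1..k} \<delta>"
    by (rule normal_e2)
  obtain \<theta> where Le1: "br x (e 1) = - (a *s e 1) - lincomb f {1..k} \<beta> + lincomb g {1..k} \<theta>"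
    using De1 by (rule normal_left_e1)
  obtain \<rho> b1 where \<rho>:
    "\<forall>i\<in>{1..k}. \<beta> i + (jordan_coeff \<rho> i + (- a) * \<rho> i) = (if i = 1 then b1 else 0)"
    by (rule jordan_cokernel)
  obtain \<rho>' b2 where \<rho>':
    "\<forall>i\<in>{1..k}. \<beta>' i + (jordan_coeff \<rho>' i + (\<gamma> 2 - a) * \<rho>' i) = (if i = 1 then b2 else 0)"
    by (rule jordan_cokernel)
  obtain \<xi> where \<xi>: "\<forall>i\<ge>1. jordan_coeff \<xi> i = - \<delta> i"
    by (rule jordan_coeff_surj)
  define e' where "e' = e(1 := e 1 + lincomb f {1..k} \<rho> + lincomb g {1..k} \<rho>',
      2 := e 2 + lincomb g {1..k} \<xi>, 3 := e 3 + lincomb g {1..k} \<rho>)"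
  interpret new: mu3_frame scale br m k N e' f x unfolding e'_def by (rule frame_change_e)
  have e'm: "e' m = e m" using m5 by (simp add: e'_def)
  have e'4: "lincomb e' {4..m} c = lincomb e {4..m} c" for c
    by (rule lincomb_cong) (auto simp: e'_def)
  have e'1: "e' 1 = e 1 + lincomb f {1..k} \<rho> + lincomb g {1..k} \<rho>'" by (simp add: e'_def)
  have e'2: "e' 2 = e 2 + lincomb g {1..k} \<xi>" by (simp add: e'_def)
  have k1': "1 \<in> {1..k}" using k1 by simp
  have "br (e' 1) x = a *s e 1 + am *s e m + lincomb f {1..k} \<beta> + lincomb g {1..k} \<beta>'
      + lincomb f {1..k} (jordan_coeff \<rho>) + lincomb g {1..k} (\<lambda>i. \<gamma> 2 * \<rho>' i + jordan_coeff \<rho>' i)"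
    unfolding e'1 br_add_left De1 right_f_span right_g_span[OF De2] ..
  also have "\<dots> = a *s e' 1 + am *s e' m
      + lincomb f {1..k} (\<lambda>i. \<beta> i + (jordan_coeff \<rho> i + (- a) * \<rho> i))
      + lincomb g {1..k} (\<lambda>i. \<beta>' i + (jordan_coeff \<rho>' i + (\<gamma> 2 - a) * \<rho>' i))"
  proof -
    have "lincomb g {1..k} (\<lambda>i. \<beta>' i + (jordan_coeff \<rho>' i + (\<gamma> 2 - a) * \<rho>' i))
        = lincomb g {1..k} \<beta>' + (lincomb g {1..k} (\<lambda>i. \<gamma> 2 * \<rho>' i + jordan_coeff \<rho>' i)
          - a *s lincomb g {1..k} \<rho>')"
      by (simp add: lincomb_add lincomb_diff lincomb_scale algebra_simps)
    moreover have "lincomb f {1..k} (\<lambda>i. \<beta> i + (jordan_coeff \<rho> i + (- a) * \<rho> i))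
        = lincomb f {1..k} \<beta> + (lincomb f {1..k} (jordan_coeff \<rho>) - a *s lincomb f {1..k} \<rho>)"
      by (simp add: lincomb_add lincomb_diff lincomb_scale)
    ultimately show ?thesis
      by (simp only: e'm e'1 scale_right_distrib) (simp add: algebra_simps)
  qed
  also have "lincomb f {1..k} (\<lambda>i. \<beta> i + (jordan_coeff \<rho> i + (- a) * \<rho> i)) = b1 *s f 1"
    unfolding lincomb_delta[of "{1..k}" 1 f b1, OF finite_atLeastAtMost k1', symmetric]
    by (rule lincomb_cong[OF refl]) (use \<rho> in simp)
  also have "lincomb g {1..k} (\<lambda>i. \<beta>' i + (jordan_coeff \<rho>' i + (\<gamma> 2 - a) * \<rho>' i)) = b2 *s f (k + 1)"
    unfolding lincomb_delta[of "{1..k}" 1 g b2, OF finite_atLeastAtMost k1', symmetric]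
    by (rule lincomb_cong[OF refl]) (simp add: \<rho>')
  finally have De1': "br (e' 1) x = a *s e' 1 + am *s e' m + b1 *s f 1 + b2 *s f (k + 1)" .
  have "lincomb g {1..k} (jordan_coeff \<xi>) = lincomb g {1..k} (\<lambda>i. - \<delta> i)"
    by (rule lincomb_cong[OF refl]) (use \<xi> in simp)
  also have "\<dots> = - lincomb g {1..k} \<delta>" by (simp add: lincomb_minus)
  finally have "br (e' 2) x = \<gamma> 2 *s e' 2 + lincomb e {4..m} \<gamma>"
    unfolding e'2 br_add_left De2 right_g_span[OF De2] lincomb_e_split3 scale_right_distrib
      lincomb_add[symmetric] lincomb_scale[symmetric]
    using g3 by simp
  then have De2': "br (e' 2) x = lincomb e' {2..m} \<gamma>"
    using g3 by (simp add: new.lincomb_e_split3 e'4)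
  have "br x (e' 1) = - (a *s e 1) - lincomb f {1..k} \<beta> + lincomb g {1..k} \<theta>
      - lincomb f {1..k} (jordan_coeff \<rho>)"
    unfolding e'1 br_add_right Le1 left_f_span left_g_span by simp
  also have "\<dots> = (- a) *s e' 1 + lincomb f {1..k} (\<lambda>i. a * \<rho> i - \<beta> i - jordan_coeff \<rho> i)
      + lincomb g {1..k} (\<lambda>i. \<theta> i + a * \<rho>' i)"
  proof -
    have "lincomb f {1..k} (\<lambda>i. a * \<rho> i - \<beta> i - jordan_coeff \<rho> i)
        = a *s lincomb f {1..k} \<rho> - lincomb f {1..k} \<beta> - lincomb f {1..k} (jordan_coeff \<rho>)"
      "lincomb g {1..k} (\<lambda>i. \<theta> i + a * \<rho>' i) = lincomb g {1..k} \<theta> + a *s lincomb g {1..k} \<rho>'"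
      by (simp_all add: lincomb_add lincomb_diff lincomb_scale)
    then show ?thesis by (simp only: e'1 scale_right_distrib) (simp add: algebra_simps)
  qed
  finally have "\<exists>a \<beta> \<theta>. br x (e' 1) = a *s e' 1 + lincomb f {1..k} \<beta> + lincomb g {1..k} \<theta>" by blast
  moreover have "br (e' 2) x = \<gamma> 2 *s e' 2 + lincomb e' {4..m} \<gamma> + lincomb g {1..k} (\<lambda>_. 0)"
    using De2' g3 by (simp add: new.lincomb_e_split3 lincomb_def[of g])
  ultimately have "pure_e_action m k e' f x" unfolding pure_e_action_def by blast
  then have "mu3_normal_frame scale br m k N e' f x"
    by unfold_locales (use left_f_exact in auto)
  with De1' De2' g3 that show ?thesis by blast
qed

text \<open>Adding a combination \<open>y\<close> of the \<open>f (k + j)\<close> to \<open>x\<close> changes \<open>[x, x]\<close> by \<open>[y, x]\<close>, that is, by the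
image of \<open>J + \<gamma> 2\<close>, and changes no product of \<open>x\<close> with elements of the ideal.\<close>

lemma reduced_square_exists:
  assumes De2: "br (e 2) x = lincomb e {2..m} \<gamma>"
  obtains y t \<delta> where "mu3_normal_frame scale br m k N e f (x + y)"
    and "\<forall>z\<in>N. br z (x + y) = br z x"
    and "br (x + y) (x + y) = lincomb e {2..m} t + \<delta> *s f (k + 1)"
proof -
  obtain t \<tau> where xx: "br x x = lincomb e {2..m} t + lincomb g {1..k} \<tau>"
    by (rule xx_coordinates)
  obtain \<sigma> \<delta> where \<sigma>:
    "\<forall>i\<in>{1..k}. \<tau> i + (jordan_coeff \<sigma> i + \<gamma> 2 * \<sigma> i) = (if i = 1 then \<delta> else 0)"
    by (rule jordan_cokernel)
  define y where "y = lincomb g {1..k} \<sigma>"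
  have yW: "y \<in> center_N" unfolding y_def by (rule g_span_in_center)
  interpret new: mu3_frame scale br m k N e f "x + y" using center_in_N[OF yW] by (rule frame_change_x)
  have right: "br z (x + y) = br z x" for z
    by (simp add: br_add_right center_right_zero[OF yW])
  have left: "br (x + y) z = br x z" if "z \<in> N" for z
    by (simp add: br_add_left center_left_zero[OF yW that])
  have "pure_e_action m k e f (x + y)"
    using pure m5 by (simp add: pure_e_action_def right left[OF e_in_N])
  then have normal: "mu3_normal_frame scale br m k N e f (x + y)"
    by unfold_locales (auto simp: left_f_exact left fk_in_N)
  have De2': "br (e 2) x = lincomb e {2..m} \<gamma> + lincomb g {1..k} (\<lambda>_. 0)"
    using De2 by (simp add: lincomb_def[of g])
  have "br (x + y) (x + y) = br x x + br y x" by (simp add: right br_add_left)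
  also have "\<dots> = lincomb e {2..m} t + lincomb g {1..k} (\<lambda>i. \<tau> i + (jordan_coeff \<sigma> i + \<gamma> 2 * \<sigma> i))"
    unfolding y_def right_g_span[OF De2'] xx
    by (simp add: lincomb_add[symmetric] add.assoc add.commute add.left_commute)
  also have "lincomb g {1..k} (\<lambda>i. \<tau> i + (jordan_coeff \<sigma> i + \<gamma> 2 * \<sigma> i))
      = lincomb g {1..k} (\<lambda>i. if i = 1 then \<delta> else 0)"
    by (rule lincomb_cong[OF refl]) (simp add: \<sigma>)
  also have "\<dots> = \<delta> *s f (k + 1)" using k1 by (simp add: lincomb_delta)
  finally have "br (x + y) (x + y) = lincomb e {2..m} t + \<delta> *s f (k + 1)" .
  with normal right that show ?thesis by blast
qed

section \<open>The multiplication table\<close>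

text \<open>The relations of \<open>normal_relations\<close> for \<open>[x, e 1]\<close> say that \<open>a 2 + J\<close> maps \<open>\<theta>\<close> to a multiple of the
first unit vector. Read from the last coordinate down, this is the geometric progression of the
\<open>\<theta> (n - i)\<close>, and the first coordinate gives the condition on \<open>a 1 * b2\<close>.\<close>

lemma multiplication_table:
  fixes n :: nat
  assumes n: "n = m + 2 * k"
    and De1: "br (e 1) x = a1 *s e 1 + am *s e m + b1 *s f 1 + b2 *s f (k + 1)"
    and De2: "br (e 2) x = lincomb e {2..m} c" and c3: "c 3 = 0"
    and xx: "br x x = lincomb e {2..m} t + \<delta>3 *s f (k + 1)"
  shows "\<exists>a b1 b2 \<beta> \<gamma> \<delta>1 \<delta>2 \<delta>3 \<theta>.
      ordered_basis UNIV (map e [1..<m + 1] @ map f [1..<2 * k + 1] @ [x]) \<and>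
      (\<forall>i\<in>{1..m}. \<forall>j\<in>{1..m}. br (e i) (e j) =
         (if 2 \<le> i \<and> i \<le> m - 1 \<and> j = 1 then e (i + 1) else 0)) \<and>
      (\<forall>i\<in>{1..m}. \<forall>j\<in>{1..2 * k}. br (e i) (f j) = (if i = 2 \<and> j \<le> k then f (k + j) else 0)) \<and>
      (\<forall>i\<in>{1..2 * k}. \<forall>j\<in>{1..m}. br (f i) (e j) = 0) \<and>
      (\<forall>i\<in>{1..2 * k}. \<forall>j\<in>{1..2 * k}. br (f i) (f j) = 0) \<and>
      br (e 1) x = a 1 *s e 1 + a m *s e m + b1 *s f 1 + b2 *s f (k + 1) \<and>
      br (e 2) x = (a 1 + a 2) *s e 2 + (\<Sum>i=4..m - 1. a i *s e i) + \<beta> *s e m \<and>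
      br (e 3) x = (2 * a 1 + a 2) *s e 3 + (\<Sum>i=5..m. a (i - 1) *s e i) + b1 *s f (k + 1) \<and>
      (\<forall>i\<in>{4..m}. br (e i) x = (of_nat (i - 1) * a 1 + a 2) *s e i
         + (\<Sum>j=i + 2..m. a (j - i + 2) *s e j)) \<and>
      (\<forall>i\<in>{1..k - 1}. br (f i) x = f i + f (i + 1) \<and> br x (f i) = - (f i + f (i + 1))) \<and>
      br (f k) x = f k \<and> br x (f k) = - f k \<and>
      (\<forall>i\<in>{1..k - 1}. br (f (k + i)) x = (a 1 + a 2 + 1) *s f (k + i) + f (k + i + 1)) \<and>
      br (f (2 * k)) x = (a 1 + a 2 + 1) *s f (2 * k) \<and>
      br x (e 1) = - (a 1 *s e 1) - b1 *s f 1 + (\<Sum>i=1..k. \<theta> (n - k + i) *s f (k + i)) \<and>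
      br x (e 2) = \<gamma> *s e m \<and>
      (\<forall>i\<in>{3..m}. br x (e i) = 0) \<and>
      (\<forall>i\<in>{1..k}. br x (f (k + i)) = 0) \<and>
      br x x = \<delta>1 *s e (m - 1) + \<delta>2 *s e m + \<delta>3 *s f (k + 1) \<and>
      (a 1 + a 2) * \<gamma> = 0 \<and>
      of_nat (m - 2) * a 1 * \<gamma> = 0 \<and>
      \<delta>1 = - a 1 * a m \<and>
      a 1 * b2 = (- 1) ^ (k - 1) * (a 2 + 1) ^ k * \<theta> n \<and>
      (\<forall>i\<in>{0..k - 1}. \<theta> (n - i) = (- 1) ^ i * (a 2 + 1) ^ i * \<theta> n)"
proof -
  have k1': "1 \<in> {1..k}" using k1 by simp
  have del: "lincomb b {1..k} (\<lambda>i. if i = 1 then s else 0) = s *s b 1" for b s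
    using k1' by (intro lincomb_delta) auto
  have De1': "br (e 1) x = a1 *s e 1 + am *s e m + lincomb f {1..k} (\<lambda>i. if i = 1 then b1 else 0)
      + lincomb g {1..k} (\<lambda>i. if i = 1 then b2 else 0)"
    using De1 by (simp only: del)
  have De2': "br (e 2) x = lincomb e {2..m} c + lincomb g {1..k} (\<lambda>_. 0)"
    using De2 by (simp add: lincomb_def[of g])
  obtain \<theta> where Le1: "br x (e 1) = - (a1 *s e 1) - lincomb f {1..k} (\<lambda>i. if i = 1 then b1 else 0)
      + lincomb g {1..k} \<theta>"
    using De1' by (rule normal_left_e1)
  have xx': "br x x = lincomb e {2..m} t + lincomb g {1..k} (\<lambda>i. if i = 1 then \<delta>3 else 0)"
    using xx by (simp only: del)
  note rel = normal_relations[OF De1' De2' Le1 xx']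
  obtain q where q: "br x (e 2) = q *s e m" "c 2 * q = 0" "of_nat (m - 2) * a1 * q = 0"
    using De1' De2' by (rule normal_left_e2)
  define a where "a i = (if i = 1 then a1 else if i = 2 then c 2 - a1 else if i = m then am else c i)" for i
  have a: "a 1 = a1" "a 2 = c 2 - a1" "a m = am" using m5 by (auto simp: a_def)
  have ai: "a i = c i" if "3 \<le> i" "i \<le> m - 1" for i using that m5 by (auto simp: a_def)
  define \<Theta> where "\<Theta> i = \<theta> (i - (n - k))" for i
  have skip: "lincomb e {i..m} d = d i *s e i + lincomb e {i + 2..m} d"
    if "i \<le> m" "d (i + 1) = 0" for i d
  proof -
    have "lincomb e {Suc i..m} d = lincomb e {i + 2..m} d"
      unfolding lincomb_def
    proof (rule sum.mono_neutral_right)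
      show "\<forall>j\<in>{Suc i..m} - {i + 2..m}. d j *s e j = 0"
      proof
        fix j assume "j \<in> {Suc i..m} - {i + 2..m}"
        then have "j = i + 1" by auto
        then show "d j *s e j = 0" using that(2) by simp
      qed
    qed auto
    then show ?thesis using lincomb_split_first[OF that(1), of e d] by simp
  qed
  have T2: "br (e 2) x = (a 1 + a 2) *s e 2 + (\<Sum>i=4..m - 1. a i *s e i) + c m *s e m"
  proof -
    have "(\<Sum>i=4..m - 1. a i *s e i) = lincomb e {4..m - 1} c"
      unfolding lincomb_def by (rule sum.cong) (auto simp: ai)
    then show ?thesis
      using lincomb_split_last[of 4 m e c] m5 by (simp add: De2 lincomb_e_split3 c3 a add.assoc)
  qed
  have T3: "br (e 3) x = (2 * a 1 + a 2) *s e 3 + (\<Sum>i=5..m. a (i - 1) *s e i) + b1 *s f (k + 1)"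
  proof -
    have "br (e 3) x = a1 *s e 3 + lincomb e {3..m} (\<lambda>i. c (i - 1)) + b1 *s f (k + 1)"
      unfolding right_e3[OF De1' De2'] del ..
    also have "lincomb e {3..m} (\<lambda>i. c (i - 1)) = c 2 *s e 3 + lincomb e {5..m} (\<lambda>i. c (i - 1))"
      using skip[of 3 "\<lambda>i. c (i - 1)"] m5 c3 by simp
    also have "lincomb e {5..m} (\<lambda>i. c (i - 1)) = (\<Sum>i=5..m. a (i - 1) *s e i)"
      unfolding lincomb_def by (rule sum.cong) (auto simp: ai)
    also have "2 * a 1 + a 2 = a1 + c 2" by (simp add: a)
    then have "a1 *s e 3 + (c 2 *s e 3 + (\<Sum>i=5..m. a (i - 1) *s e i))
        = (2 * a 1 + a 2) *s e 3 + (\<Sum>i=5..m. a (i - 1) *s e i)"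
      by (simp only: scale_left_distrib add.assoc)
    finally show ?thesis .
  qed
  have Ti: "br (e i) x = (of_nat (i - 1) * a 1 + a 2) *s e i + (\<Sum>j=i + 2..m. a (j - i + 2) *s e j)"
    if i: "i \<in> {4..m}" for i
  proof -
    have "br (e i) x = (of_nat (i - 2) * a1) *s e i + lincomb e {i..m} (\<lambda>j. c (j - i + 2))"
      using i by (intro right_e[OF De1' De2']) auto
    also have "lincomb e {i..m} (\<lambda>j. c (j - i + 2))
        = c 2 *s e i + lincomb e {i + 2..m} (\<lambda>j. c (j - i + 2))"
    proof -
      have "i + 1 - i + 2 = 3" "i - i + 2 = 2" by simp_all
      then show ?thesis using skip[of i "\<lambda>j. c (j - i + 2)"] i c3 by (simp only:) auto
    qed
    also have "lincomb e {i + 2..m} (\<lambda>j. c (j - i + 2)) = (\<Sum>j=i + 2..m. a (j - i + 2) *s e j)"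
      unfolding lincomb_def
    proof (rule sum.cong[OF refl])
      fix j assume "j \<in> {i + 2..m}"
      then have "3 \<le> j - i + 2" "j - i + 2 \<le> m - 1" using i by auto
      then show "c (j - i + 2) *s e j = a (j - i + 2) *s e j" by (simp only: ai)
    qed
    also have "of_nat (i - 1) * a 1 + a 2 = of_nat (i - 2) * a1 + c 2"
    proof -
      have "i - 1 = Suc (i - 2)" using i by auto
      then show ?thesis by (simp only: a of_nat_Suc) (simp add: algebra_simps)
    qed
    then have "(of_nat (i - 2) * a1) *s e i + (c 2 *s e i + (\<Sum>j=i + 2..m. a (j - i + 2) *s e j))
        = (of_nat (i - 1) * a 1 + a 2) *s e i + (\<Sum>j=i + 2..m. a (j - i + 2) *s e j)"
      by (simp only: scale_left_distrib add.assoc)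
    finally show ?thesis .
  qed
  have Tf: "br (f i) x = f i + f (i + 1) \<and> br x (f i) = - (f i + f (i + 1))" if "i \<in> {1..k - 1}" for i
  proof -
    have "i \<in> {1..k}" "i < k" using that by auto
    then show ?thesis by (simp add: right_f_exact left_f_exact jordan_step_def Suc_eq_plus1)
  qed
  have Tfk: "br (f k) x = f k" "br x (f k) = - f k"
    using k1 by (simp_all add: right_f_exact left_f_exact jordan_step_def)
  have Tg: "br (f (k + i)) x = (a 1 + a 2 + 1) *s f (k + i) + f (k + i + 1)" if "i \<in> {1..k - 1}" for i
  proof -
    have "i \<in> {1..k}" "i < k" using that by auto
    then show ?thesis using right_g[OF _ De2', of i]
      by (simp add: jordan_step_def a scale_left_distrib add.assoc Suc_eq_plus1)
  qed
  have Tgk: "br (f (2 * k)) x = (a 1 + a 2 + 1) *s f (2 * k)"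
    using right_g[OF _ De2', of k] k1 by (simp add: jordan_step_def a scale_left_distrib mult_2)
  have Le1': "br x (e 1) = - (a 1 *s e 1) - b1 *s f 1 + (\<Sum>i=1..k. \<Theta> (n - k + i) *s f (k + i))"
    unfolding Le1 del by (simp add: a \<Theta>_def lincomb_def)
  have xx'': "br x x = (- a 1 * a m) *s e (m - 1) + t m *s e m + \<delta>3 *s f (k + 1)"
    unfolding xx rel(1) by (simp add: a)
  have down: "\<theta> (k - i) = (- 1) ^ i * (a 2 + 1) ^ i * \<theta> k" if "i \<le> k - 1" for i
    using that
  proof (induction i)
    case (Suc i)
    then have ki: "k - i \<in> {1..k}" "1 < k - i" "k - i - 1 = k - Suc i" by auto
    have "\<theta> (k - i) + \<theta> (k - Suc i) + a 2 * \<theta> (k - i) = 0"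
      using rel(2)[OF ki(1)] ki(2,3) by (simp add: jordan_coeff_def a)
    then have "\<theta> (k - Suc i) = - ((a 2 + 1) * \<theta> (k - i))"
      by (simp add: algebra_simps eq_neg_iff_add_eq_0)
    then show ?case using Suc by simp
  qed simp
  have \<Theta>: "\<Theta> (n - i) = \<theta> (k - i)" if "i \<le> k" for i
  proof -
    have "n - i - (n - k) = k - i" using that n by simp
    then show ?thesis by (simp add: \<Theta>_def)
  qed
  have \<Theta>': "\<forall>i\<in>{0..k - 1}. \<Theta> (n - i) = (- 1) ^ i * (a 2 + 1) ^ i * \<Theta> n"
    using down \<Theta> \<Theta>[of 0] by auto
  have "\<theta> 1 + a 2 * \<theta> 1 = a1 * b2" using rel(2)[OF k1'] by (simp add: jordan_coeff_def a)
  then have "a 1 * b2 = (a 2 + 1) * \<theta> 1" unfolding a(1) distrib_right by (simp add: add.commute)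
  moreover have "k - (k - 1) = 1" using k1 by simp
  then have "\<theta> 1 = (- 1) ^ (k - 1) * (a 2 + 1) ^ (k - 1) * \<theta> k" using down[of "k - 1"] by simp
  moreover have "(a 2 + 1) ^ k = (a 2 + 1) * (a 2 + 1) ^ (k - 1)"
    using k1 by (simp add: power_eq_if)
  ultimately have b2: "a 1 * b2 = (- 1) ^ (k - 1) * (a 2 + 1) ^ k * \<Theta> n"
    using \<Theta>[of 0] by simp
  have E: "\<forall>i\<in>{1..m}. \<forall>j\<in>{1..m}. br (e i) (e j) =
      (if 2 \<le> i \<and> i \<le> m - 1 \<and> j = 1 then e (i + 1) else 0)"
    "\<forall>i\<in>{1..m}. \<forall>j\<in>{1..2 * k}. br (e i) (f j) = (if i = 2 \<and> j \<le> k then f (k + j) else 0)"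
    "\<forall>i\<in>{1..2 * k}. \<forall>j\<in>{1..m}. br (f i) (e j) = 0"
    "\<forall>i\<in>{1..2 * k}. \<forall>j\<in>{1..2 * k}. br (f i) (f j) = 0"
    by (intro ballI ee ef fe ff; assumption)+
  have X: "\<forall>i\<in>{3..m}. br x (e i) = 0" "\<forall>i\<in>{1..k}. br x (f (k + i)) = 0"
    by (intro ballI x_e_zero x_g_zero; assumption)+
  have T1: "br (e 1) x = a 1 *s e 1 + a m *s e m + b1 *s f 1 + b2 *s f (k + 1)"
    by (simp only: De1 a)
  have Q: "(a 1 + a 2) * q = 0" "of_nat (m - 2) * a 1 * q = 0"
    using q by (simp_all add: a)
  note balls = ballI[OF Ti] ballI[OF Tf] ballI[OF Tg]
  show ?thesis
    by (rule exI[of _ a], rule exI[of _ b1], rule exI[of _ b2], rule exI[of _ "c m"],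
        rule exI[of _ q], rule exI[of _ "- a 1 * a m"], rule exI[of _ "t m"],
        rule exI[of _ \<delta>3], rule exI[of _ \<Theta>], intro conjI)
      (rule frame_list_basis E T1 T2 T3 balls Tfk Tgk Le1' q(1) X xx'' Q refl b2 \<Theta>', assumption?)+
qed

end

section \<open>The first frame\<close>

context leibniz_algebra
begin

lemma matrix_of_column:
  assumes "ordered_basis V bs" "T (bs ! j) \<in> V" "j < length bs"
  shows "T (bs ! j) = (\<Sum>i<length bs. matrix_of T bs $$ (i, j) *s bs ! i)"
proof -
  have b: "distinct bs" "independent (set bs)" "T (bs ! j) \<in> span (set bs)"
    using assms by (auto simp: ordered_basis_def)
  have "T (bs ! j) = (\<Sum>b\<in>set bs. representation (set bs) (T (bs ! j)) b *s b)"
    using b by (simp add: sum_representation_eq)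
  also have "\<dots> = (\<Sum>i<length bs. representation (set bs) (T (bs ! j)) (bs ! i) *s bs ! i)"
    using b(1) by (intro sum.reindex_bij_betw[symmetric] bij_betw_nth) auto
  also have "\<dots> = (\<Sum>i<length bs. matrix_of T bs $$ (i, j) *s bs ! i)"
    using assms(3) by (intro sum.cong) (auto simp: matrix_of_def)
  finally show ?thesis .
qed

text \<open>\<open>jordan_block\<close> has its ones above the diagonal, so the image of a basis vector involves the
preceding one.\<close>

lemma jordan_block_action:
  assumes V: "ordered_basis V bs" and M: "matrix_of T bs = jordan_block k c"
    and T: "T (bs ! j) \<in> V" and j: "j < k"
  shows "length bs = k" and "T (bs ! j) = c *s bs ! j + (if j = 0 then 0 else bs ! (j - 1))"
proof -
  have "dim_row (matrix_of T bs) = dim_row (jordan_block k c)" using M by simp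
  then show l: "length bs = k" by (simp add: matrix_of_def jordan_block_def)
  have "T (bs ! j) = (\<Sum>i<k. matrix_of T bs $$ (i, j) *s bs ! i)"
    using matrix_of_column[of V bs T j] V T j l by simp
  also have "\<dots> = (\<Sum>i<k. (if i = j then c *s bs ! i else 0) + (if Suc i = j then bs ! i else 0))"
    using j by (intro sum.cong) (auto simp: M)
  also have "\<dots> = c *s bs ! j + (\<Sum>i<k. if Suc i = j then bs ! i else 0)"
    using j by (simp add: sum.distrib)
  also have "(\<Sum>i<k. if Suc i = j then bs ! i else 0) = (if j = 0 then 0 else bs ! (j - 1))"
  proof (cases j)
    case (Suc l)
    then have "(\<Sum>i<k. if Suc i = j then bs ! i else 0) = (\<Sum>i<k. if i = l then bs ! i else 0)"
      by (intro sum.cong) auto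
    then show ?thesis using Suc j by simp
  qed simp
  finally show "T (bs ! j) = c *s bs ! j + (if j = 0 then 0 else bs ! (j - 1))" .
qed

lemma projection_along_complement:
  assumes "independent (A \<union> B)" "finite A" "finite B" "A \<inter> B = {}" "v \<in> span (A \<union> B)"
  shows "projection_along A B v \<in> span A" and "v - projection_along A B v \<in> span B"
proof -
  show "projection_along A B v \<in> span A"
    unfolding projection_along_def by (intro span_sum span_scale span_base)
  have "v = (\<Sum>b\<in>A \<union> B. representation (A \<union> B) v b *s b)"
    using assms by (simp add: sum_representation_eq)
  also have "\<dots> = projection_along A B v + (\<Sum>b\<in>B. representation (A \<union> B) v b *s b)"
    using assms by (simp add: sum.union_disjoint projection_along_def)
  finally have "v - projection_along A B v = (\<Sum>b\<in>B. representation (A \<union> B) v b *s b)"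
    by (simp add: algebra_simps)
  also have "\<dots> \<in> span B" by (intro span_sum span_scale span_base)
  finally show "v - projection_along A B v \<in> span B" .
qed

text \<open>If the Jordan basis is \<open>v 0, \<dots>, v (k - 1)\<close>, the new \<open>f j\<close> is \<open>v (k - j)\<close> divided by \<open>\<lambda> ^ j\<close>: reversing
the order puts the ones below the diagonal, and the power makes them equal to 1 again after \<open>x\<close>
has been divided by \<open>\<lambda>\<close>. The new \<open>f (k + j)\<close> are the products with \<open>e 2\<close>.\<close>

lemma frame_of_mu3:
  fixes m k n :: nat
  assumes k: "1 \<le> k" and n5: "n - (2 * k + 1) \<ge> 4"
    and dim: "dim (UNIV :: 'a set) = n + 1"
    and nil: "is_nilradical N" and mu3: "is_mu3 n k N e f"
    and compl: "complementary N (span {x})"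
    and block: "single_jordan_block (span (f ` {1..k})) (eps_right_mult n k e f x) k lam"
    and lam: "lam \<noteq> 0"
  obtains e' f' x' where "mu3_frame scale br (n - 2 * k) k N e' f' x'"
proof -
  define m where "m = n - 2 * k"
  have m5: "5 \<le> m" and n: "n = m + 2 * k" using n5 by (auto simp: m_def)
  have ideal: "two_sided_ideal N" using nil by (simp add: is_nilradical_def)
  then have sN: "subspace N" and br_N: "y \<in> N \<Longrightarrow> br y w \<in> N" "y \<in> N \<Longrightarrow> br w y \<in> N" for y w
    by (auto simp: two_sided_ideal_def)
  define A B where "A = f ` {1..k}" and "B = e ` {1..m} \<union> f ` {k + 1..2 * k}"
  have f_split: "f ` {1..2 * k} = A \<union> f ` {k + 1..2 * k}"
  proof -
    have "{1..2 * k} = {1..k} \<union> {k + 1..2 * k}" by auto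
    then show ?thesis by (simp only: A_def image_Un)
  qed
  have bas: "ordered_basis N (map e [1..<m + 1] @ map f [1..<2 * k + 1])"
    and ee: "\<And>i j. i \<in> {1..m} \<Longrightarrow> j \<in> {1..m} \<Longrightarrow> br (e i) (e j) =
        (if i = 1 \<and> j = 1 then e 3 else if 2 \<le> i \<and> i \<le> m - 1 \<and> j = 1 then e (i + 1) else 0)"
    and ef: "\<And>i j. i \<in> {1..m} \<Longrightarrow> j \<in> {1..2 * k} \<Longrightarrow> br (e i) (f j) =
        (if (i = 1 \<or> i = 2) \<and> j \<le> k then f (k + j) else 0)"
    and fe: "\<And>i j. i \<in> {1..2 * k} \<Longrightarrow> j \<in> {1..m} \<Longrightarrow> br (f i) (e j) = 0"
    and ff: "\<And>i j. i \<in> {1..2 * k} \<Longrightarrow> j \<in> {1..2 * k} \<Longrightarrow> br (f i) (f j) = 0"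
    using mu3 unfolding is_mu3_def m_def[symmetric] by blast+
  have list_set: "set (map e [1..<m + 1] @ map f [1..<2 * k + 1]) = A \<union> B"
  proof -
    have "set (map e [1..<m + 1] @ map f [1..<2 * k + 1]) = e ` {1..m} \<union> f ` {1..2 * k}"
      by (auto simp: atLeastLessThanSuc_atLeastAtMost)
    then show ?thesis unfolding f_split B_def by blast
  qed
  have indep: "independent (A \<union> B)" and span_N: "span (A \<union> B) = N"
    and dist: "distinct (map e [1..<m + 1] @ map f [1..<2 * k + 1])"
    using bas unfolding ordered_basis_def list_set by auto
  have inj_f: "inj_on f {1..2 * k}" and disj: "e ` {1..m} \<inter> f ` {1..2 * k} = {}"
  proof -
    have "{1..<i + 1} = {1..i}" for i :: nat by auto
    then show "inj_on f {1..2 * k}" "e ` {1..m} \<inter> f ` {1..2 * k} = {}"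
      using dist by (auto simp only: distinct_append distinct_map set_map set_upt)
  qed
  have "f ` {1..k} \<inter> f ` {k + 1..2 * k} = {}"
    using inj_on_image_Int[OF inj_f, of "{1..k}" "{k + 1..2 * k}"] by auto
  moreover have "A \<subseteq> f ` {1..2 * k}" using f_split by blast
  ultimately have AB: "A \<inter> B = {}" using disj unfolding A_def B_def by blast
  have e_N: "e i \<in> N" if "i \<in> {1..m}" for i
    using that unfolding span_N[symmetric] B_def by (intro span_base) blast
  have f_N: "f j \<in> N" if "j \<in> {1..2 * k}" for j
    using that f_split unfolding span_N[symmetric] B_def by (intro span_base) blast

  define G where "G = span (f ` {k + 1..2 * k})"
  have F_N: "span A \<subseteq> N" and G_N: "G \<subseteq> N"
  proof -
    have "A \<subseteq> N" "f ` {k + 1..2 * k} \<subseteq> N" using f_N by (auto simp: A_def)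
    then show "span A \<subseteq> N" "G \<subseteq> N" unfolding G_def by (auto dest: span_minimal[OF _ sN])
  qed
  have left0: "br v w = 0" if "v \<in> span (f ` {1..2 * k})" "w \<in> N" for v w
  proof -
    have fw: "br (f j) w = 0" if j: "j \<in> {1..2 * k}" for j
    proof -
      have "w \<in> span (A \<union> B)" using \<open>w \<in> N\<close> span_N by simp
      then show ?thesis
      proof (induction rule: span_induct_alt)
        case (step c a y)
        then have "a \<in> e ` {1..m} \<union> f ` {1..2 * k}" unfolding f_split B_def by blast
        then show ?case using step fe[OF j] ff[OF j] by (auto simp: br_linear)
      qed (simp add: br_zero_right)
    qed
    show ?thesis using that(1)
      by (induction rule: span_induct_alt) (auto simp: br_linear fw)
  qed
  have F_sub: "span A \<subseteq> span (f ` {1..2 * k})" and G_sub: "G \<subseteq> span (f ` {1..2 * k})"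
    unfolding G_def f_split by (intro span_mono, blast)+
  have eF: "br (e 1) v = br (e 2) v" "br (e 2) v \<in> G" "i \<in> {3..m} \<Longrightarrow> br (e i) v = 0"
    if "v \<in> span A" for v i
  proof -
    have gG: "f (k + j) \<in> G" if "j \<in> {1..k}" for j
      unfolding G_def using that by (intro span_base) auto
    from that have "br (e 1) v = br (e 2) v \<and> br (e 2) v \<in> G \<and> (i \<in> {3..m} \<longrightarrow> br (e i) v = 0)"
    proof (induction rule: span_induct_alt)
      case base
      then show ?case by (simp add: br_zero_right G_def span_zero)
    next
      case (step c a y)
      from step(1) obtain j where j: "a = f j" "j \<in> {1..k}" unfolding A_def by blast
      then have "br (e 1) a = f (k + j)" "br (e 2) a = f (k + j)" "i \<in> {3..m} \<longrightarrow> br (e i) a = 0"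
        using m5 by (auto simp: ef)
      then show ?case using step gG[OF j(2)] by (auto simp: br_linear G_def span_add span_scale)
    qed
    then show "br (e 1) v = br (e 2) v" "br (e 2) v \<in> G" "i \<in> {3..m} \<Longrightarrow> br (e i) v = 0" by blast+
  qed
  have eG: "br (e i) v = 0" if "i \<in> {1..m}" "v \<in> G" for i v
    using that(2) unfolding G_def
  proof (induction rule: span_induct_alt)
    case (step c a y)
    from step(1) obtain j where "a = f j" "j \<in> {k + 1..2 * k}" by blast
    then have "br (e i) a = 0" using that(1) by (auto simp: ef)
    then show ?case using step by (simp add: br_linear)
  qed (simp add: br_zero_right)

  from block obtain gs where gs: "ordered_basis (span A) gs"
    and M: "matrix_of (eps_right_mult n k e f x) gs = jordan_block k lam"
    unfolding single_jordan_block_def A_def by blast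
  define T where "T = eps_right_mult n k e f x"
  have T: "T v = projection_along A B (br v x)" for v
    by (simp add: T_def eps_right_mult_def A_def B_def m_def right_mult_def)
  have fin: "finite A" "finite B" by (simp_all add: A_def B_def)
  have TA: "T v \<in> span A" and TB: "br v x - T v \<in> span B" if "v \<in> N" for v
    unfolding T using projection_along_complement[OF indep fin AB] br_N(1)[OF that] span_N by auto
  have gs_span: "span (set gs) = span A" using gs by (simp add: ordered_basis_def)
  have "dim_row (matrix_of T gs) = dim_row (jordan_block k lam)" using M by (simp add: T_def)
  then have len: "length gs = k" by (simp add: matrix_of_def jordan_block_def)
  have gA: "gs ! l \<in> span A" if "l < k" for l
    using that len gs_span span_base[of "gs ! l" "set gs"] by simp
  have Tg: "T (gs ! l) = lam *s gs ! l + (if l = 0 then 0 else gs ! (l - 1))" if l: "l < k" for l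
  proof (rule jordan_block_action(2)[OF gs _ _ l])
    show "matrix_of T gs = jordan_block k lam" using M by (simp add: T_def)
    show "T (gs ! l) \<in> span A" using gA[OF l] F_N by (intro TA) auto
  qed

  define e' where "e' = e(1 := e 1 - e 2)"
  define h where "h j = (inverse lam ^ j) *s gs ! (k - j)" for j
  define f' where "f' j = (if j \<le> k then h j else br (e 2) (h (j - k)))" for j
  define x' where "x' = inverse lam *s x"
  have hA: "h j \<in> span A" if "j \<in> {1..k}" for j
    unfolding h_def using that k by (intro span_scale gA) auto
  have f'A: "f' j \<in> span A" if "j \<in> {1..k}" for j using that hA by (simp add: f'_def)
  have f'G: "f' j \<in> G" if "j \<in> {k + 1..2 * k}" for j
    using that by (auto simp: f'_def intro!: eF hA)
  have f'k: "f' (k + j) = br (e 2) (f' j)" if "j \<in> {1..k}" for j using that by (simp add: f'_def)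
  have f'0: "f' j \<in> span (f ` {1..2 * k})" if "j \<in> {1..2 * k}" for j
    using that f'A[of j] f'G[of j] F_sub G_sub by (cases "j \<le> k") auto
  have f'N: "f' j \<in> N" if "j \<in> {1..2 * k}" for j
    using that f'A[of j] f'G[of j] F_N G_N by (cases "j \<le> k") auto
  have e'N: "e' i \<in> N" if "i \<in> {1..m}" for i
    using that m5 e_N[of 1] e_N[of 2] e_N[of i] sN by (auto simp: e'_def intro: subspace_diff)
  have A_f': "span A \<subseteq> span (f' ` {1..k})"
    unfolding gs_span[symmetric]
  proof (rule span_minimal)
    show "set gs \<subseteq> span (f' ` {1..k})"
    proof
      fix v assume "v \<in> set gs"
      then obtain l where l: "l < k" "v = gs ! l" using len by (auto simp: in_set_conv_nth)
      then have "f' (k - l) = inverse lam ^ (k - l) *s v" by (simp add: f'_def h_def)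
      then have "v = lam ^ (k - l) *s f' (k - l)" using lam by (simp add: power_inverse)
      moreover have "k - l \<in> {1..k}" using l k by auto
      ultimately show "v \<in> span (f' ` {1..k})" by (metis span_scale span_base imageI)
    qed
  qed simp
  have f'_split: "f' ` {1..2 * k} = f' ` {1..k} \<union> f' ` {k + 1..2 * k}"
  proof -
    have "{1..2 * k} = {1..k} \<union> {k + 1..2 * k}" by auto
    then show ?thesis by (simp only: image_Un)
  qed
  have G_f': "G \<subseteq> span (f' ` {k + 1..2 * k})"
    unfolding G_def
  proof (rule span_minimal)
    have *: "br (e 2) v \<in> span (f' ` {k + 1..2 * k})" if "v \<in> span (f' ` {1..k})" for v
      using that
    proof (induction rule: span_induct_alt)
      case (step c a y)
      from step(1) obtain j where j: "a = f' j" "j \<in> {1..k}" by blast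
      then have "br (e 2) a \<in> f' ` {k + 1..2 * k}"
        using f'k[OF j(2)] by (intro image_eqI[of _ _ "k + j"]) auto
      then show ?case using step by (simp add: br_linear span_add span_scale span_base)
    qed (simp add: br_zero_right span_zero)
    show "f ` {k + 1..2 * k} \<subseteq> span (f' ` {k + 1..2 * k})"
    proof
      fix v assume "v \<in> f ` {k + 1..2 * k}"
      then obtain j where j: "v = f j" "j \<in> {k + 1..2 * k}" by blast
      then have "j - k \<in> {1..2 * k}" "j - k \<le> k" "k + (j - k) = j" by auto
      then have "v = br (e 2) (f (j - k))" using ef[of 2 "j - k"] m5 j(1) by simp
      moreover have "f (j - k) \<in> A" unfolding A_def using j by (intro imageI) auto
      ultimately show "v \<in> span (f' ` {k + 1..2 * k})" using * A_f' span_base by blast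
    qed
  qed simp
  have e_e': "e i \<in> span (e' ` {1..m})" if "i \<in> {1..m}" for i
  proof -
    have e'b: "e' i \<in> span (e' ` {1..m})" if "i \<in> {1..m}" for i using that by (intro span_base) auto
    have "e' 1 + e' 2 = e 1" by (simp add: e'_def)
    moreover have "e' 1 + e' 2 \<in> span (e' ` {1..m})" using m5 by (intro span_add e'b) auto
    ultimately show ?thesis using e'b[OF that] by (cases "i = 1") (auto simp: e'_def)
  qed
  have e_sub: "e ` {1..m} \<subseteq> span (e' ` {1..m} \<union> f' ` {k + 1..2 * k})"
    using e_e' span_mono[of "e' ` {1..m}" "e' ` {1..m} \<union> f' ` {k + 1..2 * k}"] by blast
  have B_sub: "span B \<subseteq> span (e' ` {1..m} \<union> f' ` {k + 1..2 * k})"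
  proof (rule span_minimal)
    have "f ` {k + 1..2 * k} \<subseteq> G" by (auto simp: G_def intro: span_base)
    then have "f ` {k + 1..2 * k} \<subseteq> span (e' ` {1..m} \<union> f' ` {k + 1..2 * k})"
      using G_f' span_mono[of "f' ` {k + 1..2 * k}" "e' ` {1..m} \<union> f' ` {k + 1..2 * k}"] by blast
    then show "B \<subseteq> span (e' ` {1..m} \<union> f' ` {k + 1..2 * k})" using e_sub by (simp add: B_def)
  qed simp

  have "mu3_frame scale br m k N e' f' x'"
  proof unfold_locales
    show "5 \<le> m" "1 \<le> k" "two_sided_ideal N" by (fact m5 k ideal)+
    show "dim UNIV = m + 2 * k + 1" using dim n by simp
    show "span (e' ` {1..m} \<union> f' ` {1..2 * k}) = N"
    proof
      show "span (e' ` {1..m} \<union> f' ` {1..2 * k}) \<subseteq> N"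
        using e'N f'N sN by (intro span_minimal) auto
      have "span B \<subseteq> span (e' ` {1..m} \<union> f' ` {1..2 * k})"
        using B_sub span_mono[of "e' ` {1..m} \<union> f' ` {k + 1..2 * k}" "e' ` {1..m} \<union> f' ` {1..2 * k}"]
        unfolding f'_split by blast
      moreover have "span A \<subseteq> span (e' ` {1..m} \<union> f' ` {1..2 * k})"
        using A_f' span_mono[of "f' ` {1..k}" "e' ` {1..m} \<union> f' ` {1..2 * k}"]
        unfolding f'_split by blast
      ultimately have "A \<union> B \<subseteq> span (e' ` {1..m} \<union> f' ` {1..2 * k})"
        using span_superset by blast
      then show "N \<subseteq> span (e' ` {1..m} \<union> f' ` {1..2 * k})"
        unfolding span_N[symmetric] by (rule span_minimal) simp
    qed
    show "span (insert x' N) = UNIV"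
    proof -
      have "lam *s x' \<in> span (insert x' N)" by (intro span_scale span_base) simp
      then have "span {x} \<subseteq> span (insert x' N)"
        using lam by (intro span_minimal) (auto simp: x'_def)
      moreover have "N \<subseteq> span (insert x' N)" by (auto intro: span_base)
      ultimately have "y \<in> span (insert x' N)" if "y = u + v" "u \<in> N" "v \<in> span {x}" for y u v
        using that by (auto intro: span_add)
      then show ?thesis using compl unfolding complementary_def by blast
    qed
    show "br (e' i) (e' j) = (if 2 \<le> i \<and> i \<le> m - 1 \<and> j = 1 then e' (i + 1) else 0)"
      if "i \<in> {1..m}" "j \<in> {1..m}" for i j
    proof -
      have 12: "1 \<in> {1..m}" "2 \<in> {1..m}" using m5 by auto
      have right: "br (e l) (e' j) = br (e l) (e j)" if "l \<in> {1..m}" for l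
        using ee[OF that 12(2)] by (cases "j = 1") (simp_all add: e'_def br_diff_right)
      have e'1: "e' 1 = e 1 - e 2" by (simp add: e'_def)
      show ?thesis
      proof (cases "i = 1")
        case True
        have "br (e 1) (e j) = br (e 2) (e j)"
          using ee[OF 12(1) that(2)] ee[OF 12(2) that(2)] m5 by simp
        then have "br (e' 1) (e' j) = 0"
          unfolding e'1 br_diff_left right[OF 12(1)] right[OF 12(2)] by simp
        then show ?thesis using True by simp
      next
        case False
        then have "br (e' i) (e' j) = br (e i) (e j)" using right[OF that(1)] by (simp add: e'_def)
        then show ?thesis using ee[OF that] False by (simp add: e'_def)
      qed
    qed
    show "br (e' i) (f' j) = (if i = 2 \<and> j \<le> k then f' (k + j) else 0)"
      if i: "i \<in> {1..m}" and j: "j \<in> {1..2 * k}" for i j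
    proof (cases "j \<le> k")
      case True
      then have A: "f' j \<in> span A" and f'kj: "f' (k + j) = br (e 2) (f' j)"
        using j f'A f'k by auto
      show ?thesis
      proof (cases "i \<in> {1, 2}")
        case True
        then show ?thesis
          using eF(1)[OF A] f'kj \<open>j \<le> k\<close> by (auto simp: e'_def br_diff_left)
      next
        case False
        then have "br (e i) (f' j) = 0" using i by (intro eF(3)[OF A]) auto
        then show ?thesis using False by (simp add: e'_def)
      qed
    next
      case False
      then have "f' j \<in> G" using j f'G by auto
      then have "br (e l) (f' j) = 0" if "l \<in> {1..m}" for l using eG that by blast
      then have "br (e' i) (f' j) = 0" using i m5 by (simp add: e'_def br_diff_left)
      then show ?thesis using False by simp
    qed
    show "br (f' i) (e' j) = 0" if "i \<in> {1..2 * k}" "j \<in> {1..m}" for i j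
      using that by (intro left0 f'0 e'N)
    show "br (f' i) (f' j) = 0" if "i \<in> {1..2 * k}" "j \<in> {1..2 * k}" for i j
      using that by (intro left0 f'0 f'N)
    show "br (f' j) x' - jordan_step k f' j \<in> span (e' ` {1..m} \<union> f' ` {k + 1..2 * k})"
      if j: "j \<in> {1..k}" for j
    proof -
      define l where "l = k - j"
      have l: "l < k" using j by (auto simp: l_def)
      define c where "c = inverse lam ^ j * inverse lam"
      have clam: "c * lam = inverse lam ^ j" using lam by (simp add: c_def)
      have "br (f' j) x' = c *s br (gs ! l) x"
        using j by (simp add: f'_def h_def l_def x'_def br_linear c_def)
      moreover have "jordan_step k f' j = c *s T (gs ! l)"
      proof -
        have "f' j = (c * lam) *s gs ! l" using j by (simp add: f'_def h_def l_def clam)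
        moreover have "(if j < k then f' (Suc j) else 0) = c *s (if l = 0 then 0 else gs ! (l - 1))"
        proof (cases "j < k")
          case True
          then have "l \<noteq> 0" "k - Suc j = l - 1" by (auto simp: l_def)
          then show ?thesis using True by (simp add: f'_def h_def c_def mult.commute)
        qed (use j in \<open>auto simp: l_def\<close>)
        ultimately show ?thesis by (simp only: jordan_step_def Tg[OF l] scale_right_distrib scale_scale)
      qed
      ultimately have "br (f' j) x' - jordan_step k f' j = c *s (br (gs ! l) x - T (gs ! l))"
        by (simp add: scale_right_diff_distrib)
      also have "\<dots> \<in> span B" using gA[OF l] F_N by (intro span_scale TB) auto
      finally show ?thesis using B_sub by blast
    qed
  qed
  with that show ?thesis unfolding m_def by blast
qed

end

theorem theorem4p8:
  fixes scale :: "complex \<Rightarrow> 'a::ab_group_add \<Rightarrow> 'a" (infixr "*s" 75)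
    and br :: "'a \<Rightarrow> 'a \<Rightarrow> 'a"
    and n k :: nat
    and N :: "'a set"
    and e f :: "nat \<Rightarrow> 'a"
    and x :: 'a
    and lam :: complex
  assumes "k \<ge> 1" and "n - (2 * k + 1) \<ge> 4"
    and "leibniz_algebra scale br"
    and "vector_space.dim scale (UNIV :: 'a set) = n + 1"
    and "leibniz_algebra.solvable scale br"
    and "leibniz_algebra.is_nilradical scale br N"
    and "leibniz_algebra.is_mu3 scale br n k N e f"
    and "leibniz_algebra.complementary N (Modules.module.span scale {x})"
    and "leibniz_algebra.single_jordan_block scale (Modules.module.span scale (f ` {1..k}))
           (leibniz_algebra.eps_right_mult scale br n k e f x) k lam"
    and "lam \<noteq> 0"
  shows "\<exists>(e' :: nat \<Rightarrow> 'a) (f' :: nat \<Rightarrow> 'a) (x' :: 'a)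
           (a :: nat \<Rightarrow> complex) (b1 :: complex) (b2 :: complex) (\<beta> :: complex) (\<gamma> :: complex)
           (\<delta>1 :: complex) (\<delta>2 :: complex) (\<delta>3 :: complex) (\<theta> :: nat \<Rightarrow> complex).
      leibniz_algebra.ordered_basis scale UNIV
        (map e' [1..<n - 2 * k + 1] @ map f' [1..<2 * k + 1] @ [x']) \<and>
      (\<forall>i\<in>{1..n - 2 * k}. \<forall>j\<in>{1..n - 2 * k}. br (e' i) (e' j) =
         (if 2 \<le> i \<and> i \<le> n - 2 * k - 1 \<and> j = 1 then e' (i + 1) else 0)) \<and>
      (\<forall>i\<in>{1..n - 2 * k}. \<forall>j\<in>{1..2 * k}. br (e' i) (f' j) =
         (if i = 2 \<and> j \<le> k then f' (k + j) else 0)) \<and>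
      (\<forall>i\<in>{1..2 * k}. \<forall>j\<in>{1..n - 2 * k}. br (f' i) (e' j) = 0) \<and>
      (\<forall>i\<in>{1..2 * k}. \<forall>j\<in>{1..2 * k}. br (f' i) (f' j) = 0) \<and>
      br (e' 1) x' = a 1 *s e' 1 + a (n - 2 * k) *s e' (n - 2 * k) + b1 *s f' 1 + b2 *s f' (k + 1) \<and>
      br (e' 2) x' = (a 1 + a 2) *s e' 2 + (\<Sum>i=4..n - 2 * k - 1. a i *s e' i)
        + \<beta> *s e' (n - 2 * k) \<and>
      br (e' 3) x' = (2 * a 1 + a 2) *s e' 3 + (\<Sum>i=5..n - 2 * k. a (i - 1) *s e' i)
        + b1 *s f' (k + 1) \<and>
      (\<forall>i\<in>{4..n - 2 * k}. br (e' i) x' = (of_nat (i - 1) * a 1 + a 2) *s e' i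
         + (\<Sum>j=i + 2..n - 2 * k. a (j - i + 2) *s e' j)) \<and>
      (\<forall>i\<in>{1..k - 1}. br (f' i) x' = f' i + f' (i + 1) \<and> br x' (f' i) = - (f' i + f' (i + 1))) \<and>
      br (f' k) x' = f' k \<and> br x' (f' k) = - f' k \<and>
      (\<forall>i\<in>{1..k - 1}. br (f' (k + i)) x' = (a 1 + a 2 + 1) *s f' (k + i) + f' (k + i + 1)) \<and>
      br (f' (2 * k)) x' = (a 1 + a 2 + 1) *s f' (2 * k) \<and>
      br x' (e' 1) = - (a 1 *s e' 1) - b1 *s f' 1 + (\<Sum>i=1..k. \<theta> (n - k + i) *s f' (k + i)) \<and>
      br x' (e' 2) = \<gamma> *s e' (n - 2 * k) \<and>
      (\<forall>i\<in>{3..n - 2 * k}. br x' (e' i) = 0) \<and>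
      (\<forall>i\<in>{1..k}. br x' (f' (k + i)) = 0) \<and>
      br x' x' = \<delta>1 *s e' (n - 2 * k - 1) + \<delta>2 *s e' (n - 2 * k) + \<delta>3 *s f' (k + 1) \<and>
      (a 1 + a 2) * \<gamma> = 0 \<and>
      of_nat (n - 2 * k - 2) * a 1 * \<gamma> = 0 \<and>
      \<delta>1 = - a 1 * a (n - 2 * k) \<and>
      a 1 * b2 = (- 1) ^ (k - 1) * (a 2 + 1) ^ k * \<theta> n \<and>
      (\<forall>i\<in>{0..k - 1}. \<theta> (n - i) = (- 1) ^ i * (a 2 + 1) ^ i * \<theta> n)"
proof -
  interpret leibniz_algebra scale br by (fact assms(3))
  obtain e0 f0 x0 where "mu3_frame scale br (n - 2 * k) k N e0 f0 x0"
    by (rule frame_of_mu3[OF assms(1,2,4,6-10)])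
  then interpret fr: mu3_frame scale br "n - 2 * k" k N e0 f0 x0 .
  obtain f1 x1 where "mu3_normal_frame scale br (n - 2 * k) k N e0 f1 x1"
    by (rule fr.normal_frame_exists)
  then interpret nf: mu3_normal_frame scale br "n - 2 * k" k N e0 f1 x1 .
  obtain e2 a am b1 b2 c where nf2: "mu3_normal_frame scale br (n - 2 * k) k N e2 f1 x1"
    and De1: "br (e2 1) x1 = a *s e2 1 + am *s e2 (n - 2 * k) + b1 *s f1 1 + b2 *s f1 (k + 1)"
    and De2: "br (e2 2) x1 = lincomb e2 {2..n - 2 * k} c" and c3: "c 3 = 0"
    by (rule nf.reduced_e_exists)
  interpret nf2: mu3_normal_frame scale br "n - 2 * k" k N e2 f1 x1 by (fact nf2)
  obtain y t \<delta> where nf3: "mu3_normal_frame scale br (n - 2 * k) k N e2 f1 (x1 + y)"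
    and right: "\<forall>z\<in>N. br z (x1 + y) = br z x1"
    and xx: "br (x1 + y) (x1 + y) = lincomb e2 {2..n - 2 * k} t + \<delta> *s f1 (k + 1)"
    using De2 by (rule nf2.reduced_square_exists)
  interpret nf3: mu3_normal_frame scale br "n - 2 * k" k N e2 f1 "x1 + y" by (fact nf3)
  have "e2 1 \<in> N" "e2 2 \<in> N" using assms(2) by (auto intro: nf3.e_in_N)
  then have right12: "br (e2 1) (x1 + y) = br (e2 1) x1" "br (e2 2) (x1 + y) = br (e2 2) x1"
    using right by blast+
  have De1': "br (e2 1) (x1 + y)
      = a *s e2 1 + am *s e2 (n - 2 * k) + b1 *s f1 1 + b2 *s f1 (k + 1)"
    and De2': "br (e2 2) (x1 + y) = lincomb e2 {2..n - 2 * k} c"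
    by (simp_all only: right12 De1 De2)
  have "n = n - 2 * k + 2 * k" using assms(2) by simp
  note table = nf3.multiplication_table[OF this De1' De2' c3 xx]
  show ?thesis
    by (rule exI[of _ e2], rule exI[of _ f1], rule exI[of _ "x1 + y"], rule table)
qed

end
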